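(* Let $(V,\Omega)$ be a $6$-dimensional real symplectic vector space and let $(e_1,e_2,e_3,f_1,f_2,f_3)$ be a symplectic basis of $V$, with dual basis $(e_1^*,e_2^*,e_3^*,f_1^*,f_2^*,f_3^* )$. Consider the following list of nine (types of) effective $3$-forms on $V$: (1) $e_1^*\wedge e_2^*\wedge e_3^*+\gamma f_1^*\wedge f_2^*\wedge f_3^*$, with $\gamma\in\mathbb{R}$, $\gamma\neq 0$; (2) $f_1^*\wedge e_2^*\wedge e_3^*+f_2^*\wedge e_1^*\wedge e_3^*+f_3^*\wedge e_1^*\wedge e_2^*+\nu^2 f_1^*\wedge f_2^*\wedge f_3^*$, with $\nu\in\mathbb{R}$, $\nu\neq 0$; (3) $f_1^*\wedge e_2^*\wedge e_3^*-f_2^*\wedge e_1^*\wedge e_3^*+f_3^*\wedge e_1^*\wedge e_2^*-\nu^2 f_1^*\wedge f_2^*\wedge f_3^*$, with $\nu\in\mathbb{R}$, $\nu\neq 0$; (4) $f_1^*\wedge e_2^*\wedge e_3^*+f_2^*\wedge e_1^*\wedge e_3^*+f_3^*\wedge e_1^*\wedge e_2^*$; (5) $f_1^*\wedge e_2^*\wedge e_3^*-f_2^*\wedge e_1^*\wedge e_3^*+f_3^*\wedge e_1^*\wedge e_2^*$; (6) $f_3^*\wedge e_1^*\wedge e_2^*+f_2^*\wedge e_1^*\wedge e_3^*$; (7) $f_3^*\wedge e_1^*\wedge e_2^*-f_2^*\wedge e_1^*\wedge e_3^*$; (8) $e_1^*\wedge e_2^*\wedge e_3^*$; (9) $0$.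 Then for every effective $3$-form $\omega$ on $V$ there is one and only one entry $i\in\{1,\dots,9\}$ of this list such that $\omega$ is $Sp(6)$-equivalent to a form of type $(i)$ (for some admissible value of the parameter $\gamma$ or $\nu$ when the entry contains one).
   Context: A basis $(e_1,e_2,e_3,f_1,f_2,f_3)$ of $V$ is symplectic if $\Omega=e_1^*\wedge f_1^*+e_2^*\wedge f_2^*+e_3^*\wedge f_3^*$. A $3$-form $\omega\in\Lambda^3(V^* )$ on the $6$-dimensional symplectic space $(V,\Omega)$ is effective if $\omega\wedge\Omega=0$. $Sp(6)=Sp(V,\Omega)$ is the group of linear automorphisms of $V$ preserving $\Omega$; two $3$-forms $\omega,\omega'$ on $V$ are $Sp(6)$-equivalent if $\omega'=F^*\omega$ for some $F\in Sp(6)$. *)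

theory Defs
  imports "HOL-Analysis.Analysis" "HOL-Combinatorics.Permutations"
begin

(* A k-form on 'v takes its k arguments as a sequence x of vectors, of which only
   x 0, ..., x (k - 1) matter; the first conjunct of alternating_form makes this precise,
   so that equality of k-forms is equality of functions. *)
type_synonym 'v form = "(nat \<Rightarrow> 'v) \<Rightarrow> real"

definition alternating_form :: "nat \<Rightarrow> 'v::real_vector form \<Rightarrow> bool" where
  "alternating_form k \<alpha> \<longleftrightarrow>
     (\<forall>x y. (\<forall>i<k. x i = y i) \<longrightarrow> \<alpha> x = \<alpha> y) \<and>
     (\<forall>x. \<forall>i<k. linear (\<lambda>v. \<alpha> (x(i := v)))) \<and>
     (\<forall>x i j. i < j \<and> j < k \<and> x i = x j \<longrightarrow> \<alpha> x = 0)"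

(* Exterior product of a k-form and an l-form, normalised so that a product of 1-forms
   evaluates to the determinant, e.g. (a \<and> b)(u, v) = a u * b v - a v * b u. *)
definition wedge :: "nat \<Rightarrow> nat \<Rightarrow> 'v form \<Rightarrow> 'v form \<Rightarrow> 'v form" where
  "wedge k l \<alpha> \<beta> = (\<lambda>x.
     (\<Sum>\<sigma> | \<sigma> permutes {..<k + l}.
        of_int (sign \<sigma>) * \<alpha> (\<lambda>i. x (\<sigma> i)) * \<beta> (\<lambda>i. x (\<sigma> (k + i)))) / (fact k * fact l))"

abbreviation wedge11 :: "'v form \<Rightarrow> 'v form \<Rightarrow> 'v form" where
  "wedge11 a b \<equiv> wedge 1 1 a b"

abbreviation wedge111 :: "'v form \<Rightarrow> 'v form \<Rightarrow> 'v form \<Rightarrow> 'v form" where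
  "wedge111 a b c \<equiv> wedge 2 1 (wedge 1 1 a b) c"

definition pullback :: "('v \<Rightarrow> 'v) \<Rightarrow> 'v form \<Rightarrow> 'v form" where
  "pullback F \<alpha> = (\<lambda>x. \<alpha> (\<lambda>i. F (x i)))"

definition symplectic_form :: "'v::real_vector form \<Rightarrow> bool" where
  "symplectic_form \<Omega> \<longleftrightarrow>
     alternating_form 2 \<Omega> \<and>
     (\<forall>u. (\<forall>x. x 0 = u \<longrightarrow> \<Omega> x = 0) \<longrightarrow> u = 0)"

definition effective :: "'v::real_vector form \<Rightarrow> 'v form \<Rightarrow> bool" where
  "effective \<Omega> \<omega> \<longleftrightarrow> alternating_form 3 \<omega> \<and> wedge 3 2 \<omega> \<Omega> = (\<lambda>x. 0)"

definition symplectic_group :: "'v::real_vector form \<Rightarrow> ('v \<Rightarrow> 'v) set" where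
  "symplectic_group \<Omega> = {F. linear F \<and> bij F \<and> pullback F \<Omega> = \<Omega>}"

definition symplectic_equivalent ::
    "'v::real_vector form \<Rightarrow> 'v form \<Rightarrow> 'v form \<Rightarrow> bool" where
  "symplectic_equivalent \<Omega> \<omega> \<omega>' \<longleftrightarrow> (\<exists>F\<in>symplectic_group \<Omega>. \<omega>' = pullback F \<omega>)"

(* The element b* of the basis dual to B, as a 1-form: the b-coordinate with respect to B.
   Meaningful only if B is a basis and b \<in> B. *)
definition dual_form :: "'v::real_vector set \<Rightarrow> 'v \<Rightarrow> 'v form" where
  "dual_form B b = (\<lambda>x. representation B (x 0) b)"

definition symplectic_basis ::
    "'v::real_vector form \<Rightarrow> 'v \<Rightarrow> 'v \<Rightarrow> 'v \<Rightarrow> 'v \<Rightarrow> 'v \<Rightarrow> 'v \<Rightarrow> bool" where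
  "symplectic_basis \<Omega> e1 e2 e3 f1 f2 f3 \<longleftrightarrow>
     (let B = {e1, e2, e3, f1, f2, f3}; d = dual_form B in
        distinct [e1, e2, e3, f1, f2, f3] \<and> independent B \<and> span B = UNIV \<and>
        \<Omega> = (\<lambda>x. wedge11 (d e1) (d f1) x + wedge11 (d e2) (d f2) x + wedge11 (d e3) (d f3) x))"

(* The arguments are 1-forms: they stand for the dual basis. *)
definition normal_forms ::
    "'v form \<Rightarrow> 'v form \<Rightarrow> 'v form \<Rightarrow> 'v form \<Rightarrow> 'v form \<Rightarrow> 'v form \<Rightarrow> 'v form set list" where
  "normal_forms e1 e2 e3 f1 f2 f3 =
    [{\<lambda>x. wedge111 e1 e2 e3 x + \<gamma> * wedge111 f1 f2 f3 x | \<gamma>. \<gamma> \<noteq> 0},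
     {\<lambda>x. wedge111 f1 e2 e3 x + wedge111 f2 e1 e3 x + wedge111 f3 e1 e2 x
            + \<nu>\<^sup>2 * wedge111 f1 f2 f3 x | \<nu>. \<nu> \<noteq> 0},
     {\<lambda>x. wedge111 f1 e2 e3 x - wedge111 f2 e1 e3 x + wedge111 f3 e1 e2 x
            - \<nu>\<^sup>2 * wedge111 f1 f2 f3 x | \<nu>. \<nu> \<noteq> 0},
     {\<lambda>x. wedge111 f1 e2 e3 x + wedge111 f2 e1 e3 x + wedge111 f3 e1 e2 x},
     {\<lambda>x. wedge111 f1 e2 e3 x - wedge111 f2 e1 e3 x + wedge111 f3 e1 e2 x},
     {\<lambda>x. wedge111 f3 e1 e2 x + wedge111 f2 e1 e3 x},
     {\<lambda>x. wedge111 f3 e1 e2 x - wedge111 f2 e1 e3 x},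
     {wedge111 e1 e2 e3},
     {\<lambda>x. 0}]"

definition normal_forms_of_type ::
    "'v::real_vector \<Rightarrow> 'v \<Rightarrow> 'v \<Rightarrow> 'v \<Rightarrow> 'v \<Rightarrow> 'v \<Rightarrow> nat \<Rightarrow> 'v form set" where
  "normal_forms_of_type e1 e2 e3 f1 f2 f3 i =
     (let d = dual_form {e1, e2, e3, f1, f2, f3} in
        normal_forms (d e1) (d e2) (d e3) (d f1) (d f2) (d f3) ! (i - 1))"

end

theory Submission
  imports Defs
begin

text \<open>
  Existence. Write $\omega(e,x,y) = \Omega(A_e x, y)$ and let $U$ be the symplectic complement of the
  plane of $e_1, f_1$. The compression of $A_{e_1}$ to $U$ squares to a scalar $\mu$. If $\mu \neq 0$,
  the frame can be changed, keeping $e_1$, so that $\omega(e_1, f_1, \cdot) = 0$ and $A_{f_1}$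
  anticommutes with $A_{e_1}$ on $U$. If $A_{f_1} \neq 0$, the two operators generate a Clifford algebra
  acting on $U$, and the orbit of a suitable vector under them is a symplectic basis of $U$ in which
  $\omega$ has only the four coefficients on $f_1 e_2 e_3$, $f_2 e_1 e_3$, $f_3 e_1 e_2$ and
  $f_1 f_2 f_3$; rescaling and permuting the indices gives types (1)--(5). If $A_{f_1} = 0$, an
  auxiliary operator anticommuting with $A_{e_1}$ takes its place and gives types (6) and (7).
  If $\mu = 0$ in every frame and $\omega \neq 0$, some coefficient on $e_1 e_2 e_3$ is nonzero, a
  shear $f \mapsto f + Se$ with $S$ symmetric removes the coefficients on $f_i e_j e_k$, and
  $\mu = 0$ then forces all others to vanish.

  Uniqueness. The quadratic form $q(X) = tr(A_X^2)$ is carried along by $Sp(6)$. The types are told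
  apart by whether $q$ is zero, of rank one, degenerate or nondegenerate, by the sign of $q$, by the
  existence of a vector $X$ with $q(X, \cdot) = c\,\Omega(X, \cdot)$, $c \neq 0$, and by whether
  $\omega$ vanishes.
\<close>

section \<open>Exterior products in low degree\<close>

text \<open>Nested insertions let \<open>sum_over_permutations_insert\<close> peel off one index at
  a time.\<close>

lemma lessThan_2_insert: "{..<2::nat} = insert 0 {1}"
  by auto

lemma lessThan_3_insert: "{..<3::nat} = insert 0 (insert 1 {2})"
  by auto

lemma lessThan_5_insert: "{..<5::nat} = insert 0 (insert 1 (insert 2 (insert 3 {4})))"
  by auto

lemma wedge_1_1:
  "wedge 1 1 (\<lambda>x. a (x 0)) (\<lambda>x. b (x 0)) = (\<lambda>x. a (x 0) * b (x 1) - a (x 1) * b (x 0))"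
proof -
  have f: "finite {1::nat}" "0 \<notin> {1::nat}" by auto
  show ?thesis
    unfolding wedge_def one_add_one lessThan_2_insert sum_over_permutations_insert[OF f]
      permutes_sing
    by (simp add: sign_swap_id permutation_swap_id sign_compose transpose_def)
qed

lemma wedge_1_1_1:
  "wedge111 (\<lambda>x. a (x 0)) (\<lambda>x. b (x 0)) (\<lambda>x. c (x 0)) =
     (\<lambda>x. a (x 0) * (b (x 1) * c (x 2) - b (x 2) * c (x 1))
        - a (x 1) * (b (x 0) * c (x 2) - b (x 2) * c (x 0))
        + a (x 2) * (b (x 0) * c (x 1) - b (x 1) * c (x 0)))"
proof -
  have f: "finite {1::nat, 2}" "0 \<notin> {1::nat, 2}" "finite {2::nat}" "1 \<notin> {2::nat}" by auto
  have e: "2 + 1 = (3::nat)" by simp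
  show ?thesis
    unfolding wedge_1_1
    unfolding wedge_def e lessThan_3_insert
      sum_over_permutations_insert[OF f(1,2)] sum_over_permutations_insert[OF f(3,4)]
      permutes_sing add_0_right
    by (simp add: sign_swap_id permutation_swap_id permutation_compose sign_compose
        transpose_def field_simps diff_divide_distrib add_divide_distrib)
qed

text \<open>The 120 permutations fall into ten classes, one for each pair of indices given to
  \<open>W\<close>. A class has 3! 2! = 12 members with equal contributions, and the normalisation
  in \<open>wedge\<close> cancels this factor.\<close>

lemma wedge_3_2:
  assumes T: "\<And>x y z. T x y z = - T y x z" "\<And>x y z. T x y z = - T x z y"
    and W: "\<And>x y. W x y = - W y x"
  shows "wedge 3 2 (\<lambda>x. T (x 0) (x 1) (x 2)) (\<lambda>x. W (x 0) (x 1)) =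
     (\<lambda>x. T (x 0) (x 1) (x 2) * W (x 3) (x 4) - T (x 0) (x 1) (x 3) * W (x 2) (x 4)
        + T (x 0) (x 1) (x 4) * W (x 2) (x 3) + T (x 0) (x 2) (x 3) * W (x 1) (x 4)
        - T (x 0) (x 2) (x 4) * W (x 1) (x 3) + T (x 0) (x 3) (x 4) * W (x 1) (x 2)
        - T (x 1) (x 2) (x 3) * W (x 0) (x 4) + T (x 1) (x 2) (x 4) * W (x 0) (x 3)
        - T (x 1) (x 3) (x 4) * W (x 0) (x 2) + T (x 2) (x 3) (x 4) * W (x 0) (x 1))"
proof
  fix x :: "nat \<Rightarrow> 'a"
  have f: "finite {1::nat, 2, 3, 4}" "0 \<notin> {1::nat, 2, 3, 4}" "finite {2::nat, 3, 4}"
    "1 \<notin> {2::nat, 3, 4}" "finite {3::nat, 4}" "2 \<notin> {3::nat, 4}" "finite {4::nat}" "3 \<notin> {4::nat}"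
    by auto
  have e: "3 + 2 = (5::nat)" by simp
  have T': "T (x j) (x i) (x k) = - T (x i) (x j) (x k)"
    "T (x k) (x i) (x j) = T (x i) (x j) (x k)"
    "T (x i) (x k) (x j) = - T (x i) (x j) (x k)"
    "T (x j) (x k) (x i) = T (x i) (x j) (x k)"
    "T (x k) (x j) (x i) = - T (x i) (x j) (x k)" for i j k :: nat
    using T by metis+
  have W': "W (x j) (x i) = - W (x i) (x j)" for i j :: nat
    by (rule W)
  \<comment> \<open>Instantiated only at increasing indices, the sign rules rewrite towards sorted
    arguments and therefore terminate.\<close>
  note s = T'[where i=0 and j=1 and k=2] T'[where i=0 and j=1 and k=3] T'[where i=0 and j=1 and
    k=4] T'[where i=0 and j=2 and k=3] T'[where i=0 and j=2 and k=4] T'[where i=0 and j=3 and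
    k=4] T'[where i=1 and j=2 and k=3] T'[where i=1 and j=2 and k=4] T'[where i=1 and j=3 and
    k=4] T'[where i=2 and j=3 and k=4] W'[where i=0 and j=1] W'[where i=0 and j=2] W'[where i=0
    and j=3] W'[where i=0 and j=4] W'[where i=1 and j=2] W'[where i=1 and j=3] W'[where i=1 and
    j=4] W'[where i=2 and j=3] W'[where i=2 and j=4] W'[where i=3 and j=4]
  have *: "(\<Sum>\<sigma> | \<sigma> permutes {..<5}.
        of_int (sign \<sigma>) * T (x (\<sigma> 0)) (x (\<sigma> 1)) (x (\<sigma> 2)) * W (x (\<sigma> (3 + 0))) (x (\<sigma> (3 + 1))))
      = 12 * (T (x 0) (x 1) (x 2) * W (x 3) (x 4) - T (x 0) (x 1) (x 3) * W (x 2) (x 4)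
        + T (x 0) (x 1) (x 4) * W (x 2) (x 3) + T (x 0) (x 2) (x 3) * W (x 1) (x 4)
        - T (x 0) (x 2) (x 4) * W (x 1) (x 3) + T (x 0) (x 3) (x 4) * W (x 1) (x 2)
        - T (x 1) (x 2) (x 3) * W (x 0) (x 4) + T (x 1) (x 2) (x 4) * W (x 0) (x 3)
        - T (x 1) (x 3) (x 4) * W (x 0) (x 2) + T (x 2) (x 3) (x 4) * W (x 0) (x 1))"
    unfolding lessThan_5_insert
      sum_over_permutations_insert[OF f(1,2)] sum_over_permutations_insert[OF f(3,4)]
      sum_over_permutations_insert[OF f(5,6)] sum_over_permutations_insert[OF f(7,8)]
      permutes_sing
    by (simp add: sign_swap_id permutation_swap_id permutation_compose sign_compose
        transpose_def s[unfolded One_nat_def])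
  show "wedge 3 2 (\<lambda>x. T (x 0) (x 1) (x 2)) (\<lambda>x. W (x 0) (x 1)) x =
        T (x 0) (x 1) (x 2) * W (x 3) (x 4) - T (x 0) (x 1) (x 3) * W (x 2) (x 4)
        + T (x 0) (x 1) (x 4) * W (x 2) (x 3) + T (x 0) (x 2) (x 3) * W (x 1) (x 4)
        - T (x 0) (x 2) (x 4) * W (x 1) (x 3) + T (x 0) (x 3) (x 4) * W (x 1) (x 2)
        - T (x 1) (x 2) (x 3) * W (x 0) (x 4) + T (x 1) (x 2) (x 4) * W (x 0) (x 3)
        - T (x 1) (x 3) (x 4) * W (x 0) (x 2) + T (x 2) (x 3) (x 4) * W (x 0) (x 1)"
    unfolding wedge_def e * by (simp add: fact_numeral)
qed

section \<open>Symplectic frames\<close>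

text \<open>The dimension bound makes every frame below a basis; nondegeneracy comes with the
  existence of a frame.\<close>

locale symplectic_space =
  fixes W :: "'v::real_vector \<Rightarrow> 'v \<Rightarrow> real"
  assumes W_add_left: "W (x + y) z = W x z + W y z"
    and W_scale_left: "W (c *\<^sub>R x) z = c * W x z"
    and W_anti: "W x y = - W y x"
    and dim_le_6: "\<exists>S. finite S \<and> card S \<le> 6 \<and> span S = (UNIV :: 'v set)"
begin

lemma W_add_right: "W z (x + y) = W z x + W z y"
  by (metis W_add_left W_anti minus_add_distrib)

lemma W_scale_right: "W z (c *\<^sub>R x) = c * W z x"
  by (metis W_anti W_scale_left mult_minus_right)

lemma W_minus_left: "W (- x) z = - W x z"
  using W_scale_left[of "-1" x z] by simp

lemma W_minus_right: "W z (- x) = - W z x"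
  using W_scale_right[of z "-1" x] by simp

lemma W_diff_left: "W (x - y) z = W x z - W y z"
  using W_add_left[of x "- y" z] by (simp add: W_minus_left)

lemma W_diff_right: "W z (x - y) = W z x - W z y"
  using W_add_right[of z x "- y"] by (simp add: W_minus_right)

lemma W_same [simp]: "W x x = 0"
  using W_anti[of x x] by simp

lemma W_zero_left [simp]: "W 0 x = 0"
  using W_scale_left[of 0 0 x] by simp

lemma W_zero_right [simp]: "W x 0 = 0"
  using W_scale_right[of x 0 0] by simp

lemmas W_linear = W_add_left W_add_right W_scale_left W_scale_right W_minus_left W_minus_right
  W_diff_left W_diff_right

text \<open>A symplectic basis recorded by its pairings alone; independence and spanning are derived
  from them.\<close>

definition frame :: "'v \<Rightarrow> 'v \<Rightarrow> 'v \<Rightarrow> 'v \<Rightarrow> 'v \<Rightarrow> 'v \<Rightarrow> bool" where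
  "frame e1 e2 e3 f1 f2 f3 \<longleftrightarrow>
     W e1 e2 = 0 \<and> W e1 e3 = 0 \<and> W e2 e3 = 0 \<and> W f1 f2 = 0 \<and> W f1 f3 = 0 \<and> W f2 f3 = 0 \<and>
     W e1 f1 = 1 \<and> W e1 f2 = 0 \<and> W e1 f3 = 0 \<and> W e2 f1 = 0 \<and> W e2 f2 = 1 \<and> W e2 f3 = 0 \<and>
     W e3 f1 = 0 \<and> W e3 f2 = 0 \<and> W e3 f3 = 1"

lemma frame_W:
  assumes "frame e1 e2 e3 f1 f2 f3"
  shows "W e1 e2 = 0" "W e1 e3 = 0" "W e2 e3 = 0" "W f1 f2 = 0" "W f1 f3 = 0" "W f2 f3 = 0"
    "W e1 f1 = 1" "W e1 f2 = 0" "W e1 f3 = 0" "W e2 f1 = 0" "W e2 f2 = 1" "W e2 f3 = 0"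
    "W e3 f1 = 0" "W e3 f2 = 0" "W e3 f3 = 1"
    "W e2 e1 = 0" "W e3 e1 = 0" "W e3 e2 = 0" "W f2 f1 = 0" "W f3 f1 = 0" "W f3 f2 = 0"
    "W f1 e1 = - 1" "W f2 e1 = 0" "W f3 e1 = 0" "W f1 e2 = 0" "W f2 e2 = - 1" "W f3 e2 = 0"
    "W f1 e3 = 0" "W f2 e3 = 0" "W f3 e3 = - 1"
  using assms W_anti[of e2 e1] W_anti[of e3 e1] W_anti[of e3 e2] W_anti[of f2 f1]
    W_anti[of f3 f1] W_anti[of f3 f2] W_anti[of f1 e1] W_anti[of f1 e2] W_anti[of f1 e3]
    W_anti[of f2 e1] W_anti[of f2 e2] W_anti[of f2 e3] W_anti[of f3 e1] W_anti[of f3 e2]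
    W_anti[of f3 e3]
  unfolding frame_def by simp_all

lemma frame_distinct:
  assumes "frame e1 e2 e3 f1 f2 f3"
  shows "distinct [e1, e2, e3, f1, f2, f3]"
  using frame_W[OF assms] by auto

lemma frame_independent:
  assumes "frame e1 e2 e3 f1 f2 f3"
  shows "independent {e1, e2, e3, f1, f2, f3}"
proof -
  note fr = frame_W[OF assms]
  have "u b = 0" if u: "(\<Sum>v\<in>{e1, e2, e3, f1, f2, f3}. u v *\<^sub>R v) = 0"
    and b: "b \<in> {e1, e2, e3, f1, f2, f3}" for u b
  proof -
    have z: "u e1 *\<^sub>R e1 + u e2 *\<^sub>R e2 + u e3 *\<^sub>R e3 + u f1 *\<^sub>R f1 + u f2 *\<^sub>R f2 + u f3 *\<^sub>R f3
      = 0"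
      using u frame_distinct[OF assms] by (simp add: add.assoc)
    have "W (u e1 *\<^sub>R e1 + u e2 *\<^sub>R e2 + u e3 *\<^sub>R e3 + u f1 *\<^sub>R f1 + u f2 *\<^sub>R f2
      + u f3 *\<^sub>R f3) y = 0" for y
      unfolding z by simp
    from this[of f1] this[of f2] this[of f3] this[of e1] this[of e2] this[of e3]
    show ?thesis using b by (auto simp: W_linear fr)
  qed
  then show ?thesis
    unfolding dependent_finite[OF finite.insertI[OF finite.insertI[OF finite.insertI[OF
      finite.insertI[OF finite.insertI[OF finite.insertI[OF finite.emptyI]]]]]]]
    by blast
qed

text \<open>A vector outside the span would give seven independent vectors in a space spanned by at
  most six. The coordinates are then read off by pairing with the frame.\<close>

lemma frame_expand:
  assumes "frame e1 e2 e3 f1 f2 f3"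
  shows "v = W v f1 *\<^sub>R e1 + W v f2 *\<^sub>R e2 + W v f3 *\<^sub>R e3
           + W e1 v *\<^sub>R f1 + W e2 v *\<^sub>R f2 + W e3 v *\<^sub>R f3"
proof -
  note fr = frame_W[OF assms]
  let ?B = "{e1, e2, e3, f1, f2, f3}"
  obtain S :: "'v set" where S: "finite S" "card S \<le> 6" "span S = UNIV" using dim_le_6 by blast
  have c: "card ?B = 6" using frame_distinct[OF assms] by simp
  have "v \<in> span ?B"
  proof (rule ccontr)
    assume v: "v \<notin> span ?B"
    then have "v \<notin> ?B" by (metis span_base)
    then have "card (insert v ?B) = Suc (card ?B)" by (intro card_insert_disjoint) simp_all
    moreover have "independent (insert v ?B)"
      using v frame_independent[OF assms] by (rule independent_insertI)
    moreover have "insert v ?B \<subseteq> span S" unfolding S(3) by (rule subset_UNIV)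
    ultimately have "Suc (card ?B) \<le> card S"
      by (metis independent_span_bound[OF S(1)])
    then show False using S(2) c by linarith
  qed
  then obtain c1 c2 c3 d1 d2 d3 where
    "v - c1 *\<^sub>R e1 - c2 *\<^sub>R e2 - c3 *\<^sub>R e3 - d1 *\<^sub>R f1 - d2 *\<^sub>R f2 - d3 *\<^sub>R f3 = 0"
    unfolding span_breakdown_eq span_empty by blast
  then have v: "v = c1 *\<^sub>R e1 + c2 *\<^sub>R e2 + c3 *\<^sub>R e3
      + d1 *\<^sub>R f1 + d2 *\<^sub>R f2 + d3 *\<^sub>R f3"
    by (simp add: algebra_simps)
  show ?thesis unfolding v by (simp add: W_linear fr)
qed

text \<open>The bivector inverse to the symplectic form is the same in every frame.\<close>

lemma casimir:
  fixes \<beta> :: "'v \<Rightarrow> 'v \<Rightarrow> real"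
  assumes ef: "frame e1 e2 e3 f1 f2 f3" and gh: "frame g1 g2 g3 h1 h2 h3"
    and \<beta>: "bilinear \<beta>"
  shows "\<beta> e1 f1 + \<beta> e2 f2 + \<beta> e3 f3 - \<beta> f1 e1 - \<beta> f2 e2 - \<beta> f3 e3
       = \<beta> g1 h1 + \<beta> g2 h2 + \<beta> g3 h3 - \<beta> h1 g1 - \<beta> h2 g2 - \<beta> h3 g3"
proof -
  note lin = bilinear_ladd[OF \<beta>] bilinear_radd[OF \<beta>] bilinear_lmul[OF \<beta>] bilinear_rmul[OF \<beta>]
    bilinear_lneg[OF \<beta>] bilinear_rneg[OF \<beta>] bilinear_lsub[OF \<beta>] bilinear_rsub[OF \<beta>]
  \<comment> \<open>Left slots on one side are expanded in the second frame, right slots on the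
    other side in the first. Both sides become combinations of the same values of \<beta> with equal
    coefficients.\<close>
  have l: "\<beta> v y = W v h1 * \<beta> g1 y + W v h2 * \<beta> g2 y + W v h3 * \<beta> g3 y
      + W g1 v * \<beta> h1 y + W g2 v * \<beta> h2 y + W g3 v * \<beta> h3 y" for v y
    by (subst frame_expand[OF gh, of v]) (simp add: lin)
  have r: "\<beta> x v = - W f1 v * \<beta> x e1 - W f2 v * \<beta> x e2 - W f3 v * \<beta> x e3
      + W e1 v * \<beta> x f1 + W e2 v * \<beta> x f2 + W e3 v * \<beta> x f3" for v x
    by (subst frame_expand[OF ef, of v]) (simp add: lin W_anti[of v])
  note a = W_anti[of g1 e1] W_anti[of g1 e2] W_anti[of g1 e3] W_anti[of g1 f1] W_anti[of g1 f2]
    W_anti[of g1 f3] W_anti[of g2 e1] W_anti[of g2 e2] W_anti[of g2 e3] W_anti[of g2 f1]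
    W_anti[of g2 f2] W_anti[of g2 f3] W_anti[of g3 e1] W_anti[of g3 e2] W_anti[of g3 e3]
    W_anti[of g3 f1] W_anti[of g3 f2] W_anti[of g3 f3]
  show ?thesis
    unfolding r[of g1 h1] r[of g2 h2] r[of g3 h3] r[of h1 g1] r[of h2 g2] r[of h3 g3]
    unfolding l[of e1 f1] l[of e2 f2] l[of e3 f3] l[of f1 e1] l[of f2 e2] l[of f3 e3]
    unfolding a
    by algebra
qed

end

section \<open>Trilinear forms in a symplectic frame\<close>

definition det3 :: "('v \<Rightarrow> real) \<Rightarrow> ('v \<Rightarrow> real) \<Rightarrow> ('v \<Rightarrow> real) \<Rightarrow> 'v \<Rightarrow> 'v \<Rightarrow> 'v \<Rightarrow> real" where
  "det3 a b c x y z = a x * (b y * c z - b z * c y) - a y * (b x * c z - b z * c x)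
     + a z * (b x * c y - b y * c x)"

locale symplectic_trilinear = symplectic_space W for W :: "'v::real_vector \<Rightarrow> 'v \<Rightarrow> real" +
  fixes T :: "'v \<Rightarrow> 'v \<Rightarrow> 'v \<Rightarrow> real"
  assumes T_add_1: "T (x + x') y z = T x y z + T x' y z"
    and T_scale_1: "T (c *\<^sub>R x) y z = c * T x y z"
    and T_swap_12: "T y x z = - T x y z"
    and T_swap_23: "T x z y = - T x y z"
begin

lemma T_perm:
  shows "T x z y = - T x y z" "T y x z = - T x y z" "T z y x = - T x y z"
    "T y z x = T x y z" "T z x y = T x y z"
  by (metis T_swap_12 T_swap_23)+

lemma T_add_2: "T x (y + y') z = T x y z + T x y' z"
  by (simp add: T_swap_12[of x] T_add_1)

lemma T_add_3: "T x y (z + z') = T x y z + T x y z'"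
  by (simp add: T_swap_23[of x y] T_add_2)

lemma T_scale_2: "T x (c *\<^sub>R y) z = c * T x y z"
  by (simp add: T_swap_12[of x] T_scale_1)

lemma T_scale_3: "T x y (c *\<^sub>R z) = c * T x y z"
  by (simp add: T_swap_23[of x y] T_scale_2)

lemma T_minus: "T (- x) y z = - T x y z" "T x (- y) z = - T x y z" "T x y (- z) = - T x y z"
  using T_scale_1[of "-1" x y z] T_scale_2[of x "-1" y z] T_scale_3[of x y "-1" z] by simp_all

lemma T_diff: "T (x - x') y z = T x y z - T x' y z" "T x (y - y') z = T x y z - T x y' z"
  "T x y (z - z') = T x y z - T x y z'"
  using T_add_1[of x "- x'" y z] T_add_2[of x y "- y'" z] T_add_3[of x y z "- z'"]
  by (simp_all add: T_minus)

lemma T_same [simp]: "T x x y = 0" "T x y x = 0" "T y x x = 0"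
  using T_swap_12[of x x y] T_perm(3)[of x y x] T_swap_23[of y x x] by simp_all

lemmas T_linear = T_add_1 T_add_2 T_add_3 T_scale_1 T_scale_2 T_scale_3 T_minus T_diff

end

locale trilinear_frame = symplectic_trilinear W T
  for W :: "'v::real_vector \<Rightarrow> 'v \<Rightarrow> real" and T +
  fixes e1 e2 e3 f1 f2 f3 :: 'v
  assumes frame: "frame e1 e2 e3 f1 f2 f3"
begin

lemmas W_frame = frame_W[OF frame]

text \<open>Only increasing triples are instantiated, so that rewriting terminates with arguments in
  the order \<open>e1, e2, e3, f1, f2, f3\<close>.\<close>

lemmas T_sort =
  T_perm[where x=e1 and y=e2 and z=e3] T_perm[where x=e1 and y=e2 and z=f1]
  T_perm[where x=e1 and y=e2 and z=f2] T_perm[where x=e1 and y=e2 and z=f3]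
  T_perm[where x=e1 and y=e3 and z=f1] T_perm[where x=e1 and y=e3 and z=f2]
  T_perm[where x=e1 and y=e3 and z=f3] T_perm[where x=e1 and y=f1 and z=f2]
  T_perm[where x=e1 and y=f1 and z=f3] T_perm[where x=e1 and y=f2 and z=f3]
  T_perm[where x=e2 and y=e3 and z=f1] T_perm[where x=e2 and y=e3 and z=f2]
  T_perm[where x=e2 and y=e3 and z=f3] T_perm[where x=e2 and y=f1 and z=f2]
  T_perm[where x=e2 and y=f1 and z=f3] T_perm[where x=e2 and y=f2 and z=f3]
  T_perm[where x=e3 and y=f1 and z=f2] T_perm[where x=e3 and y=f1 and z=f3]
  T_perm[where x=e3 and y=f2 and z=f3] T_perm[where x=f1 and y=f2 and z=f3]

lemmas expand_simps = W_linear W_frame T_linear T_sort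

text \<open>An alternating trilinear form is determined by its 20 values on sorted triples of frame
  vectors. The functionals \<open>X1\<close> to \<open>Y3\<close> are the dual basis, so each value
  comes with a 3 by 3 minor.\<close>

lemma T_coords:
  fixes x y z
  defines "X1 \<equiv> \<lambda>v. W v f1" and "X2 \<equiv> \<lambda>v. W v f2" and "X3 \<equiv> \<lambda>v. W v f3"
    and "Y1 \<equiv> W e1" and "Y2 \<equiv> W e2" and "Y3 \<equiv> W e3"
  shows "T x y z =
    T e1 e2 e3 * det3 X1 X2 X3 x y z + T e1 e2 f1 * det3 X1 X2 Y1 x y z
    + T e1 e2 f2 * det3 X1 X2 Y2 x y z + T e1 e2 f3 * det3 X1 X2 Y3 x y z
    + T e1 e3 f1 * det3 X1 X3 Y1 x y z + T e1 e3 f2 * det3 X1 X3 Y2 x y z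
    + T e1 e3 f3 * det3 X1 X3 Y3 x y z + T e1 f1 f2 * det3 X1 Y1 Y2 x y z
    + T e1 f1 f3 * det3 X1 Y1 Y3 x y z + T e1 f2 f3 * det3 X1 Y2 Y3 x y z
    + T e2 e3 f1 * det3 X2 X3 Y1 x y z + T e2 e3 f2 * det3 X2 X3 Y2 x y z
    + T e2 e3 f3 * det3 X2 X3 Y3 x y z + T e2 f1 f2 * det3 X2 Y1 Y2 x y z
    + T e2 f1 f3 * det3 X2 Y1 Y3 x y z + T e2 f2 f3 * det3 X2 Y2 Y3 x y z
    + T e3 f1 f2 * det3 X3 Y1 Y2 x y z + T e3 f1 f3 * det3 X3 Y1 Y3 x y z
    + T e3 f2 f3 * det3 X3 Y2 Y3 x y z + T f1 f2 f3 * det3 Y1 Y2 Y3 x y z"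
proof -
  have expand: "v = X1 v *\<^sub>R e1 + X2 v *\<^sub>R e2 + X3 v *\<^sub>R e3 + Y1 v *\<^sub>R f1 + Y2 v *\<^sub>R f2
    + Y3 v *\<^sub>R f3"
    for v
    using frame_expand[OF frame, of v] unfolding X1_def X2_def X3_def Y1_def Y2_def Y3_def .
  have 1: "T v y z = X1 v * T e1 y z + X2 v * T e2 y z + X3 v * T e3 y z
      + Y1 v * T f1 y z + Y2 v * T f2 y z + Y3 v * T f3 y z" for v y z
    by (subst expand[of v]) (simp only: T_linear)
  have 2: "T x v z = X1 v * T x e1 z + X2 v * T x e2 z + X3 v * T x e3 z
      + Y1 v * T x f1 z + Y2 v * T x f2 z + Y3 v * T x f3 z" for v x z
    by (subst expand[of v]) (simp only: T_linear)
  have 3: "T x y v = X1 v * T x y e1 + X2 v * T x y e2 + X3 v * T x y e3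
      + Y1 v * T x y f1 + Y2 v * T x y f2 + Y3 v * T x y f3" for v x y
    by (subst expand[of v]) (simp only: T_linear)
  show ?thesis
    unfolding 1[of x y z]
    unfolding 2[of _ y z]
    unfolding 3[of _ _ z]
    unfolding T_same T_sort det3_def
    by algebra
qed

end

section \<open>Effective forms and changes of frame\<close>

text \<open>Vanishing of the exterior product with the symplectic form, restated as vanishing of the
  contraction of \<open>T\<close> with the bivector inverse to \<open>W\<close>;
  \<open>effective_imp_trilinear\<close> links the two.\<close>

locale effective_trilinear = symplectic_trilinear W T for W :: "'v::real_vector \<Rightarrow> 'v \<Rightarrow> real"
  and T +
  assumes effective: "frame e1 e2 e3 f1 f2 f3 \<Longrightarrow> T u e1 f1 + T u e2 f2 + T u e3 f3 = 0"
begin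

lemma trilinear_frame: "frame e1 e2 e3 f1 f2 f3 \<Longrightarrow> trilinear_frame W T e1 e2 e3 f1 f2 f3"
  by unfold_locales

text \<open>Taking \<open>u\<close> to be each frame vector in turn gives six linear relations,
  leaving 14 of the 20 coefficients free.\<close>

lemma effective_relations:
  assumes "frame e1 e2 e3 f1 f2 f3"
  shows "T e1 e3 f3 = - T e1 e2 f2" "T e2 e3 f3 = T e1 e2 f1" "T e2 e3 f2 = - T e1 e3 f1"
    "T e3 f1 f3 = - T e2 f1 f2" "T e3 f2 f3 = T e1 f1 f2" "T e2 f2 f3 = - T e1 f1 f3"
proof -
  interpret trilinear_frame W T e1 e2 e3 f1 f2 f3
    using assms by (rule trilinear_frame)
  show "T e1 e3 f3 = - T e1 e2 f2" "T e2 e3 f3 = T e1 e2 f1" "T e2 e3 f2 = - T e1 e3 f1"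
    "T e3 f1 f3 = - T e2 f1 f2" "T e3 f2 f3 = T e1 f1 f2" "T e2 f2 f3 = - T e1 f1 f3"
    using effective[OF assms, of e1] effective[OF assms, of e2] effective[OF assms, of e3]
      effective[OF assms, of f1] effective[OF assms, of f2] effective[OF assms, of f3]
    by (simp_all add: T_sort)
qed

text \<open>In terms of the dual frame, the form is
  $a_0 e_1 e_2 e_3 + a_1 f_1 e_2 e_3 + a_2 f_2 e_1 e_3 + a_3 f_3 e_1 e_2 + k f_1 f_2 f_3$; this
  five-parameter family contains all nine types. The arguments of each coefficient are sorted
  as $e_1, e_2, e_3, f_1, f_2, f_3$.\<close>

definition diagonal :: "real \<Rightarrow> real \<Rightarrow> real \<Rightarrow> real \<Rightarrow> real \<Rightarrow> 'v \<Rightarrow> 'v \<Rightarrow> 'v \<Rightarrow> 'v \<Rightarrow> 'v \<Rightarrow> 'v \<Rightarrow> bool"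
  where "diagonal a0 a1 a2 a3 k e1 e2 e3 f1 f2 f3 \<longleftrightarrow>
    frame e1 e2 e3 f1 f2 f3 \<and> T e1 e2 e3 = a0 \<and> T e2 e3 f1 = a1 \<and> T e1 e3 f2 = a2 \<and>
    T e1 e2 f3 = a3 \<and>
    T f1 f2 f3 = k \<and> T e1 f2 f3 = 0 \<and> T e2 f1 f3 = 0 \<and> T e3 f1 f2 = 0 \<and>
    T e1 e2 f1 = 0 \<and> T e1 e3 f1 = 0 \<and> T e1 f1 f2 = 0 \<and> T e1 f1 f3 = 0 \<and>
    T e1 e2 f2 = 0 \<and> T e2 e3 f2 = 0 \<and> T e2 f1 f2 = 0 \<and> T e2 f2 f3 = 0 \<and>
    T e1 e3 f3 = 0 \<and> T e2 e3 f3 = 0 \<and> T e3 f1 f3 = 0 \<and> T e3 f2 f3 = 0"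

lemma diagonal_trilinear_frame:
  assumes "diagonal a0 a1 a2 a3 k e1 e2 e3 f1 f2 f3"
  shows "trilinear_frame W T e1 e2 e3 f1 f2 f3"
  using assms unfolding diagonal_def by (elim conjE) (rule trilinear_frame)

lemma diagonal_values:
  assumes "diagonal a0 a1 a2 a3 k e1 e2 e3 f1 f2 f3"
  shows "T e1 e2 e3 = a0" "T e2 e3 f1 = a1" "T e1 e3 f2 = a2" "T e1 e2 f3 = a3" "T f1 f2 f3 = k"
    "T e1 f2 f3 = 0" "T e2 f1 f3 = 0" "T e3 f1 f2 = 0"
    "T e1 e2 f1 = 0" "T e1 e3 f1 = 0" "T e1 f1 f2 = 0" "T e1 f1 f3 = 0"
    "T e1 e2 f2 = 0" "T e2 e3 f2 = 0" "T e2 f1 f2 = 0" "T e2 f2 f3 = 0"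
    "T e1 e3 f3 = 0" "T e2 e3 f3 = 0" "T e3 f1 f3 = 0" "T e3 f2 f3 = 0"
  using assms unfolding diagonal_def by simp_all

section \<open>Elementary changes of frame\<close>

definition has_form :: "real \<Rightarrow> real \<Rightarrow> real \<Rightarrow> real \<Rightarrow> real \<Rightarrow> bool" where
  "has_form a0 a1 a2 a3 k \<longleftrightarrow> (\<exists>e1 e2 e3 f1 f2 f3. diagonal a0 a1 a2 a3 k e1 e2 e3 f1 f2 f3)"

lemma has_form_swap_12:
  assumes "has_form 0 a1 a2 a3 k"
  shows "has_form 0 a2 a1 (- a3) (- k)"
proof -
  from assms obtain e1 e2 e3 f1 f2 f3 where d: "diagonal 0 a1 a2 a3 k e1 e2 e3 f1 f2 f3"
    unfolding has_form_def by blast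
  then interpret trilinear_frame W T e1 e2 e3 f1 f2 f3
    by (rule diagonal_trilinear_frame)
  have "diagonal 0 a2 a1 (- a3) (- k) e2 e1 e3 f2 f1 f3"
    unfolding diagonal_def frame_def by (simp add: W_frame T_sort diagonal_values[OF d])
  then show ?thesis unfolding has_form_def by blast
qed

lemma has_form_swap_23:
  assumes "has_form 0 a1 a2 a3 k"
  shows "has_form 0 (- a1) a3 a2 (- k)"
proof -
  from assms obtain e1 e2 e3 f1 f2 f3 where d: "diagonal 0 a1 a2 a3 k e1 e2 e3 f1 f2 f3"
    unfolding has_form_def by blast
  then interpret trilinear_frame W T e1 e2 e3 f1 f2 f3
    by (rule diagonal_trilinear_frame)
  have "diagonal 0 (- a1) a3 a2 (- k) e1 e3 e2 f1 f3 f2"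
    unfolding diagonal_def frame_def by (simp add: W_frame T_sort diagonal_values[OF d])
  then show ?thesis unfolding has_form_def by blast
qed

text \<open>Multiplying each e_i by s_i and dividing f_i by s_i preserves all pairings.\<close>

lemma has_form_scale:
  assumes "has_form a0 a1 a2 a3 k" and s: "s1 \<noteq> 0" "s2 \<noteq> 0" "s3 \<noteq> 0"
  shows "has_form (a0 * (s1 * s2 * s3)) (a1 * (s2 * s3 / s1)) (a2 * (s1 * s3 / s2))
    (a3 * (s1 * s2 / s3)) (k / (s1 * s2 * s3))"
proof -
  from assms obtain e1 e2 e3 f1 f2 f3 where d: "diagonal a0 a1 a2 a3 k e1 e2 e3 f1 f2 f3"
    unfolding has_form_def by blast
  then interpret trilinear_frame W T e1 e2 e3 f1 f2 f3
    by (rule diagonal_trilinear_frame)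
  have "diagonal (a0 * (s1 * s2 * s3)) (a1 * (s2 * s3 / s1)) (a2 * (s1 * s3 / s2))
      (a3 * (s1 * s2 / s3)) (k / (s1 * s2 * s3))
      (s1 *\<^sub>R e1) (s2 *\<^sub>R e2) (s3 *\<^sub>R e3) ((1 / s1) *\<^sub>R f1) ((1 / s2) *\<^sub>R f2) ((1 / s3) *\<^sub>R f3)"
    unfolding diagonal_def frame_def using s
    by (simp add: W_frame W_linear T_linear diagonal_values[OF d])
  then show ?thesis unfolding has_form_def by blast
qed

text \<open>Here the form is half the sum of the decomposable forms $\prod_j (c_j f_j + e_j)$ and
  $\prod_j (c_j f_j - e_j)$, up to the factor $b$.\<close>

lemma has_form_hyperbolic:
  assumes "has_form 0 (b * c1) (- (b * c2)) (b * c3) (b * (c1 * c2 * c3))"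
    and c: "c1 \<noteq> 0" "c2 \<noteq> 0" "c3 \<noteq> 0"
  shows "has_form (b / 2) 0 0 0 (4 * b * (c1 * c2 * c3))"
proof -
  from assms obtain e1 e2 e3 f1 f2 f3
    where d: "diagonal 0 (b * c1) (- (b * c2)) (b * c3) (b * (c1 * c2 * c3)) e1 e2 e3 f1 f2 f3"
    unfolding has_form_def by blast
  then interpret trilinear_frame W T e1 e2 e3 f1 f2 f3
    by (rule diagonal_trilinear_frame)
  \<comment> \<open>The reciprocals are kept only through polynomial relations, so that
    \<open>algebra\<close> applies.\<close>
  define u1 u2 u3 v :: real where uv: "u1 = 1 / (2 * c1)" "u2 = 1 / (2 * c2)"
    "u3 = 1 / (2 * c3)" "v = 1 / 2"
  have u: "2 * u1 * c1 = 1" "2 * u2 * c2 = 1" "2 * u3 * c3 = 1" and v: "2 * v = 1"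
    using c unfolding uv by simp_all
  \<comment> \<open>Each new e_j is annihilated by the covector c_j f_j - e_j and each new f_j by
    c_j f_j + e_j, so the two products become the two surviving monomials.\<close>
  have "diagonal (b * v) 0 0 0 (4 * b * (c1 * c2 * c3))
      (v *\<^sub>R e1 + u1 *\<^sub>R f1) (v *\<^sub>R e2 + u2 *\<^sub>R f2) (v *\<^sub>R e3 + u3 *\<^sub>R f3)
      (f1 - c1 *\<^sub>R e1) (f2 - c2 *\<^sub>R e2) (f3 - c3 *\<^sub>R e3)"
    unfolding diagonal_def frame_def
    unfolding expand_simps diagonal_values[OF d] T_same W_same
    by (intro conjI; (simp only: mult_zero_right mult_zero_left mult_minus_right mult_minus_left
        minus_minus minus_zero add_0_left add_0_right)?; (algebra | use u v in algebra)?)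
  moreover have "b * v = b / 2" unfolding uv by simp
  ultimately show ?thesis unfolding has_form_def by metis
qed

end

section \<open>Self-adjoint operators on the symplectic complement of \<open>e1\<close> and
  \<open>f1\<close>\<close>

context trilinear_frame
begin

definition comb :: "real \<Rightarrow> real \<Rightarrow> real \<Rightarrow> real \<Rightarrow> 'v" where
  "comb a b c d = a *\<^sub>R e2 + b *\<^sub>R e3 + c *\<^sub>R f2 + d *\<^sub>R f3"

lemma W_comb_left: "W (comb a b c d) y = a * W e2 y + b * W e3 y - c * W y f2 - d * W y f3"
  unfolding comb_def by (simp add: W_linear W_anti[of f2] W_anti[of f3])

lemma W_comb_right: "W y (comb a b c d) = - a * W e2 y - b * W e3 y + c * W y f2 + d * W y f3"
  by (subst W_anti) (simp add: W_comb_left)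

text \<open>The projection onto the span of \<open>e2, e3, f2, f3\<close> along that of
  \<open>e1, f1\<close>.\<close>

definition proj :: "'v \<Rightarrow> 'v" where
  "proj x = comb (W x f2) (W x f3) (W e2 x) (W e3 x)"

text \<open>On the span of $e_2, e_3, f_2, f_3$ this is the traceless self-adjoint operator $A$
  for which the 2-form $W(Ax, y)$ takes the values $t, s, w, p, r$ on the pairs
  $(e_2,f_2), (e_2,f_3), (e_3,f_2), (e_2,e_3), (f_2,f_3)$. Its square is the scalar
  $t^2 + sw + pr$.\<close>

definition form_op :: "real \<Rightarrow> real \<Rightarrow> real \<Rightarrow> real \<Rightarrow> real \<Rightarrow> 'v \<Rightarrow> 'v" where
  "form_op t s w p r x = comb (t * W x f2 + w * W x f3 - r * W e3 x) (s * W x f2 - t * W x f3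
  + r * W e2 x)
     (p * W x f3 + t * W e2 x + s * W e3 x) (- p * W x f2 + w * W e2 x - t * W e3 x)"

lemma form_op_self_adjoint: "W (form_op t s w p r x) y = W x (form_op t s w p r y)"
  unfolding form_op_def W_comb_left W_comb_right by algebra

lemma W_form_op_skew: "W (form_op t s w p r x) x = 0"
  using form_op_self_adjoint[of t s w p r x x] W_anti[of x "form_op t s w p r x"] by linarith

lemma W_form_op_frame: "W (form_op t s w p r x) e1 = 0" "W (form_op t s w p r x) f1 = 0"
  unfolding form_op_def W_comb_left by (simp_all add: W_frame)

lemma comb_cong: "a = a' \<Longrightarrow> b = b' \<Longrightarrow> c = c' \<Longrightarrow> d = d' \<Longrightarrow> comb a b c d = comb a' b' c' d'"
  by simp

lemma comb_scale: "c *\<^sub>R comb a1 a2 a3 a4 = comb (c * a1) (c * a2) (c * a3) (c * a4)"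
  unfolding comb_def by (simp add: algebra_simps)

lemma comb_minus: "- comb a1 a2 a3 a4 = comb (- a1) (- a2) (- a3) (- a4)"
  unfolding comb_def by (simp add: algebra_simps)

lemma form_op_scale: "form_op t s w p r (c *\<^sub>R x) = c *\<^sub>R form_op t s w p r x"
  unfolding form_op_def comb_scale by (rule comb_cong) (simp_all add: W_linear algebra_simps)

lemma form_op_add: "form_op t s w p r (x + y) = form_op t s w p r x + form_op t s w p r y"
  unfolding form_op_def comb_def by (simp add: W_linear algebra_simps)

text \<open>A self-adjoint operator on a symplectic 4-space is a root of a quadratic polynomial, the
  Pfaffian square root of its characteristic polynomial; tracelessness removes the linear term.
  \<open>proj\<close> appears because \<open>e1\<close> and \<open>f1\<close> are sent to
  zero.\<close>

lemma form_op_square: "form_op t s w p r (form_op t s w p r x) = (t\<^sup>2 + s * w + p * r) *\<^sub>R proj x"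
  unfolding form_op_def[of t s w p r "form_op t s w p r x"] proj_def comb_scale
  unfolding form_op_def[of t s w p r x] W_comb_left W_comb_right W_frame W_same
  by (rule comb_cong) algebra+

text \<open>The assumption polarises the quadratic form of \<open>form_op_square\<close>: orthogonal
  coefficient tuples satisfy the Clifford relation.\<close>

lemma form_op_anticommute:
  assumes "2 * t * t' + s * w' + w * s' + p * r' + r * p' = 0"
  shows "form_op t s w p r (form_op t' s' w' p' r' x)
    = - form_op t' s' w' p' r' (form_op t s w p r x)"
  unfolding form_op_def[of t s w p r "form_op t' s' w' p' r' x"]
    form_op_def[of t' s' w' p' r' "form_op t s w p r x"] comb_minus
  unfolding form_op_def[of t s w p r x] form_op_def[of t' s' w' p' r' x] W_comb_left
    W_comb_right W_frame W_same
  by (rule comb_cong; use assms in algebra)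

lemma form_op_proj: "form_op t s w p r (proj x) = form_op t s w p r x"
  unfolding form_op_def[of _ _ _ _ _ "proj x"]
    unfolding proj_def W_comb_left W_comb_right W_frame W_same
  unfolding form_op_def by (rule comb_cong) algebra+

lemma proj_proj: "proj (proj x) = proj x"
  unfolding proj_def[of "proj x"] unfolding proj_def W_comb_left W_comb_right W_frame W_same
  by (rule comb_cong) simp_all

lemma proj_form_op: "proj (form_op t s w p r x) = form_op t s w p r x"
  unfolding proj_def form_op_def W_comb_left W_comb_right W_frame W_same
  by (rule comb_cong) simp_all

lemma W_proj: "W (proj x) e1 = 0" "W (proj x) f1 = 0"
  unfolding proj_def W_comb_left by (simp_all add: W_frame)

lemma W_form_op_proj: "W (form_op t s w p r x) (proj y) = W (form_op t s w p r x) y"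
  by (metis form_op_proj form_op_self_adjoint)

text \<open>The four vanishing coefficients confine \<open>T e1\<close> to the complement; the last
  assumption, which effectivity supplies, is tracelessness.\<close>

lemma T_e1_form_op:
  assumes "T e1 e2 f1 = 0" "T e1 e3 f1 = 0" "T e1 f1 f2 = 0" "T e1 f1 f3 = 0"
    and "T e1 e3 f3 = - T e1 e2 f2"
  shows "T e1 x y = W (form_op (T e1 e2 f2) (T e1 e2 f3) (T e1 e3 f2) (T e1 e2 e3)
    (T e1 f2 f3) x) y"
  unfolding form_op_def W_comb_left
  by (subst T_coords) (use assms in \<open>simp add: det3_def W_frame algebra_simps\<close>)

text \<open>The counterpart for \<open>f1\<close>; the minus signs come from moving
  \<open>f1\<close> to the front of a sorted triple.\<close>

lemma T_f1_form_op:
  assumes "T e1 e2 f1 = 0" "T e1 e3 f1 = 0" "T e1 f1 f2 = 0" "T e1 f1 f3 = 0"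
    and "T e3 f1 f3 = - T e2 f1 f2"
  shows "T f1 x y = W (form_op (- T e2 f1 f2) (- T e2 f1 f3) (- T e3 f1 f2) (T e2 e3 f1)
    (T f1 f2 f3) x) y"
  unfolding form_op_def W_comb_left
  by (subst T_coords) (use assms in \<open>simp add: det3_def W_frame algebra_simps\<close>)

text \<open>Anticommutation makes $W(Gu, Bv)$ symmetric in $u$ and $v$, so it vanishes identically if it
  vanishes for $u = v$.\<close>

lemma exists_anisotropic:
  assumes \<mu>: "t\<^sup>2 + s * w + p * r \<noteq> 0"
    and anti: "2 * t * t' + s * w' + w * s' + p * r' + r * p' = 0"
    and nz: "\<not> (t' = 0 \<and> s' = 0 \<and> w' = 0 \<and> p' = 0 \<and> r' = 0)"
  shows "\<exists>u. proj u = u \<and> W (form_op t' s' w' p' r' u) (form_op t s w p r u) \<noteq> 0"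
proof (rule ccontr)
  let ?B = "form_op t s w p r" and ?G = "form_op t' s' w' p' r'"
  assume "\<not> ?thesis"
  then have z: "W (?G u) (?B u) = 0" for u
    using proj_proj[of u] by (metis form_op_proj)
  have sym: "W (?G u) (?B v) = W (?G v) (?B u)" for u v
  proof -
    have "W (?G u) (?B v) = W (?B (?G u)) v" by (simp add: form_op_self_adjoint)
    also have "\<dots> = - W (?G (?B u)) v" by (simp add: form_op_anticommute[OF anti] W_minus_left)
    also have "\<dots> = - W (?B u) (?G v)" by (simp add: form_op_self_adjoint)
    also have "\<dots> = W (?G v) (?B u)" by (subst W_anti) simp
    finally show ?thesis .
  qed
  have "W (?G u) (?B v) = 0" for u v
    using z[of "u + v"] z[of u] z[of v] sym[of u v] by (simp add: form_op_add W_linear)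
  \<comment> \<open>Since \<open>?B (?B v)\<close> is a nonzero multiple of \<open>proj v\<close>,
    it follows that \<open>?G u\<close> pairs to zero with every vector, and all coefficients of
    \<open>?G\<close> vanish.\<close>
  then have "W (?G u) (?B (?B v)) = 0" for u v by blast
  then have "W (?G u) v = 0" for u v
    using \<mu> by (simp add: form_op_square W_linear W_form_op_proj)
  then have "W (?G e2) e3 = 0" "W (?G e2) f2 = 0" "W (?G e2) f3 = 0" "W (?G e3) f2 = 0"
    "W (?G f2) f3 = 0" by blast+
  then show False using nz unfolding form_op_def W_comb_left by (simp add: W_frame)
qed

end

context effective_trilinear
begin

text \<open>If $h = W(Gu, Bu) \neq 0$, the new frame is $e_1, u, Bu, f_1, -BGu/h, -Gu/h$.\<close>

lemma has_form_anticommuting: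
  assumes fr: "frame e1 e2 e3 f1 f2 f3"
    and \<alpha>: "T e1 e2 f1 = 0" "T e1 e3 f1 = 0" "T e1 f1 f2 = 0" "T e1 f1 f3 = 0"
    and B: "\<And>x y. T e1 x y = W (trilinear_frame.form_op W e2 e3 f2 f3 t s w p r x) y"
    and G: "\<And>x y. T f1 x y = c * W (trilinear_frame.form_op W e2 e3 f2 f3 t' s' w' p' r' x) y"
    and \<mu>: "t\<^sup>2 + s * w + p * r \<noteq> 0"
    and anti: "2 * t * t' + s * w' + w * s' + p * r' + r * p' = 0"
    and nz: "\<not> (t' = 0 \<and> s' = 0 \<and> w' = 0 \<and> p' = 0 \<and> r' = 0)"
  shows "\<exists>h k. h \<noteq> 0 \<and> has_form 0 (c * h) (t\<^sup>2 + s * w + p * r) 1 k \<and> (c = 0 \<longrightarrow> k = 0)"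
proof -
  interpret trilinear_frame W T e1 e2 e3 f1 f2 f3
    using fr by (rule trilinear_frame)
  let ?B = "form_op t s w p r" and ?G = "form_op t' s' w' p' r'"
  define \<mu> where "\<mu> = t\<^sup>2 + s * w + p * r"
  obtain u where u: "proj u = u" and h: "W (?G u) (?B u) \<noteq> 0"
    using exists_anisotropic[OF \<mu> anti nz] by blast
  define h where "h = W (?G u) (?B u)"
  define f2' where "f2' = (- 1 / h) *\<^sub>R ?B (?G u)"
  define f3' where "f3' = (- 1 / h) *\<^sub>R ?G u"
  have h0: "h \<noteq> 0" using h unfolding h_def .
  have BB: "?B (?B u) = \<mu> *\<^sub>R u" by (simp add: form_op_square \<mu>_def u)
  have GB: "?G (?B u) = - ?B (?G u)" by (simp add: form_op_anticommute[OF anti])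
  \<comment> \<open>Skewness, self-adjointness and \<open>BB\<close> leave \<open>h\<close>, up to
    sign, as the only nonzero pairing among \<open>u\<close>, \<open>?B u\<close>,
    \<open>?G u\<close> and \<open>?B (?G u)\<close>.\<close>
  have W1: "W u (?B u) = 0" "W u (?G u) = 0" "W (?B u) (?G u) = - h" "W u (?B (?G u)) = - h"
    "W (?B u) (?B (?G u)) = 0" "W (?G u) (?B (?G u)) = 0" "W (?G u) (?B u) = h"
  proof -
    show "W u (?B u) = 0" "W u (?G u) = 0"
      using W_form_op_skew by (simp_all flip: form_op_self_adjoint)
    show "W (?B u) (?G u) = - h" unfolding h_def by (rule W_anti)
    then show "W u (?B (?G u)) = - h" by (simp flip: form_op_self_adjoint)
    show "W (?B u) (?B (?G u)) = 0"
      unfolding form_op_self_adjoint[of t s w p r "?B u" "?G u", symmetric] BB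
      using \<open>W u (?G u) = 0\<close> by (simp add: W_linear)
    show "W (?G u) (?B (?G u)) = 0"
      by (subst W_anti) (simp add: W_form_op_skew)
    show "W (?G u) (?B u) = h" unfolding h_def ..
  qed
  have e1_f1: "W e1 x = 0" "W f1 x = 0" if "W x e1 = 0" "W x f1 = 0" for x
    using that W_anti[of e1 x] W_anti[of f1 x] by simp_all
  have u1: "W u e1 = 0" "W u f1 = 0" using W_proj[of u] unfolding u by simp_all
  note W0 = u1 W_form_op_frame e1_f1[OF u1] e1_f1[OF W_form_op_frame]
  have BG_G: "W (?B (?G u)) (?G u) = 0" by (rule W_form_op_skew)
  have fr': "frame e1 u (?B u) f1 f2' f3'"
    unfolding frame_def f2'_def f3'_def
    using h0 by (simp add: W_linear W1 W0 W_frame BG_G)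
  have f1_0: "T e1 f1 x = 0" for x
    unfolding B form_op_def W_comb_left by (simp add: W_frame)
  have "T f1 (?B u) f2' = 0" "T f1 (?B u) f3' = 0" "T f1 u f2' = 0" "T f1 u f3' = 0"
    unfolding G f2'_def f3'_def GB by (simp_all add: W_linear W1 BG_G)
  moreover have "T e1 f2' f3' = 0"
    unfolding B f2'_def f3'_def form_op_scale form_op_square proj_form_op by (simp add: W_linear)
  moreover have "T e1 u (?B u) = 0" "T e1 u f2' = 0" "T e1 u f3' = 1" "T e1 (?B u) f2' = \<mu>"
      "T e1 (?B u) f3' = 0"
    unfolding B BB f2'_def f3'_def using h0 by (simp_all add: W_linear W1)
  moreover have "T f1 u (?B u) = c * h" unfolding G using W1 by simp
  moreover have "T u (?B u) f1 = T f1 u (?B u)" "T u f1 f2' = - T f1 u f2'"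
    "T u f1 f3' = - T f1 u f3'"
      "T (?B u) f1 f2' = - T f1 (?B u) f2'" "T (?B u) f1 f3' = - T f1 (?B u) f3'"
      "T e1 u f1 = - T e1 f1 u" "T e1 (?B u) f1 = - T e1 f1 (?B u)"
    by (rule T_perm)+
  \<comment> \<open>Coefficients not computed above follow from effectivity in the new
    frame.\<close>
  ultimately have d: "diagonal 0 (c * h) \<mu> 1 (T f1 f2' f3') e1 u (?B u) f1 f2' f3'"
    unfolding diagonal_def using fr' f1_0 effective_relations[OF fr'] by simp
  have "c = 0 \<Longrightarrow> T f1 f2' f3' = 0" unfolding G by simp
  with d h0 show ?thesis unfolding has_form_def \<mu>_def by blast
qed

section \<open>Existence of a normal form\<close>

text \<open>Given \<open>T e1 e3 f3 = - T e1 e2 f2\<close>, this is the Pfaffian of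
  \<open>T e1\<close> on \<open>e2, e3, f2, f3\<close>, and by \<open>form_op_square\<close> the
  scalar \<mu> to which the compressed operator squares.\<close>

definition pfaffian :: "'v \<Rightarrow> 'v \<Rightarrow> 'v \<Rightarrow> 'v \<Rightarrow> 'v \<Rightarrow> real" where
  "pfaffian e1 e2 e3 f2 f3 = (T e1 e2 f2)\<^sup>2 + T e1 e2 f3 * T e1 e3 f2 + T e1 e2 e3 * T e1 f2 f3"

text \<open>A nonzero Pfaffian makes the compressed operator of \<open>e1\<close> invertible, so
  \<open>T e1 f1\<close> can be cancelled by adding to \<open>f1\<close> a vector of the
  complement.\<close>

lemma frame_splitting:
  assumes fr: "frame e1 e2 e3 f1 f2 f3" and pf: "pfaffian e1 e2 e3 f2 f3 \<noteq> 0"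
  shows "\<exists>e2' e3' f1' f2' f3'. frame e1 e2' e3' f1' f2' f3' \<and> pfaffian e1 e2' e3' f2' f3' \<noteq> 0 \<and>
    T e1 e2' f1' = 0 \<and> T e1 e3' f1' = 0 \<and> T e1 f1' f2' = 0 \<and> T e1 f1' f3' = 0"
proof -
  interpret trilinear_frame W T e1 e2 e3 f1 f2 f3
    using fr by (rule trilinear_frame)
  define m where "m = pfaffian e1 e2 e3 f2 f3"
  define i where "i = 1 / m"
  note rel = effective_relations(1)[OF fr]
  have i: "i * m = 1" using pf unfolding i_def m_def by simp
  note i' = i[unfolded m_def pfaffian_def]
  define t s w p r where coeffs: "t = T e1 e2 f2" "s = T e1 e2 f3" "w = T e1 e3 f2"
    "p = T e1 e2 e3" "r = T e1 f2 f3"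
  define c2 c3 d2 d3 where cd: "c2 = T e1 f1 f2" "c3 = T e1 f1 f3" "d2 = T e1 e2 f1"
    "d3 = T e1 e3 f1"
  \<comment> \<open>Coordinates of -Bz/m, where B is the operator of \<open>e1\<close> and z
    represents \<open>T e1 f1\<close> through \<open>W\<close> on the complement. As B squares to
    \<open>m\<close>, this vector solves Bx = -z.\<close>
  define x2 x3 y2 y3 where xy: "x2 = - i * (t * c2 + w * c3 - r * d3)"
    "x3 = - i * (s * c2 - t * c3 + r * d2)"
    "y2 = - i * (p * c3 + t * d2 + s * d3)" "y3 = - i * (- p * c2 + w * d2 - t * d3)"
  \<comment> \<open>The multiples of \<open>e1\<close> restore the pairings with the changed
    \<open>f1\<close>.\<close>
  let ?e2 = "e2 - y2 *\<^sub>R e1" and ?e3 = "e3 - y3 *\<^sub>R e1" and ?f2 = "f2 + x2 *\<^sub>R e1"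
    and ?f3 = "f3 + x3 *\<^sub>R e1"
    and ?f1 = "f1 + x2 *\<^sub>R e2 + x3 *\<^sub>R e3 + y2 *\<^sub>R f2 + y3 *\<^sub>R f3"
  have "frame e1 ?e2 ?e3 ?f1 ?f2 ?f3"
    unfolding frame_def by (simp add: W_linear W_frame)
  moreover have "pfaffian e1 ?e2 ?e3 ?f2 ?f3 = m"
    unfolding pfaffian_def m_def by (simp add: T_linear T_sort)
  moreover have "T e1 ?e2 ?f1 = 0" "T e1 ?e3 ?f1 = 0" "T e1 ?f1 ?f2 = 0" "T e1 ?f1 ?f3 = 0"
    unfolding expand_simps T_same rel coeffs[symmetric] cd[symmetric]
    unfolding xy using i'[folded coeffs] by algebra+
  ultimately show ?thesis using pf unfolding m_def by metis
qed

text \<open>A Gram-Schmidt step: adding \<open>c *\<^sub>R e1\<close> to \<open>f1\<close> adds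
  \<open>c\<close> times the operator of \<open>e1\<close> to that of \<open>f1\<close>. The final
  equation is the hypothesis \<open>anti\<close> of \<open>has_form_anticommuting\<close>.\<close>

lemma frame_orthogonal:
  assumes fr: "frame e1 e2 e3 f1 f2 f3" and pf: "pfaffian e1 e2 e3 f2 f3 \<noteq> 0"
    and \<alpha>: "T e1 e2 f1 = 0" "T e1 e3 f1 = 0" "T e1 f1 f2 = 0" "T e1 f1 f3 = 0"
  shows "\<exists>f1'. frame e1 e2 e3 f1' f2 f3 \<and>
    T e1 e2 f1' = 0 \<and> T e1 e3 f1' = 0 \<and> T e1 f1' f2 = 0 \<and> T e1 f1' f3 = 0 \<and>
    2 * T e1 e2 f2 * - T e2 f1' f2 + T e1 e2 f3 * - T e3 f1' f2 + T e1 e3 f2 * - T e2 f1' f3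
      + T e1 e2 e3 * T f1' f2 f3 + T e1 f2 f3 * T e2 e3 f1' = 0"
proof -
  interpret trilinear_frame W T e1 e2 e3 f1 f2 f3
    using fr by (rule trilinear_frame)
  define i where "i = 1 / pfaffian e1 e2 e3 f2 f3"
  have i: "i * pfaffian e1 e2 e3 f2 f3 = 1" using pf unfolding i_def by simp
  define k where "k = 2 * T e1 e2 f2 * - T e2 f1 f2 + T e1 e2 f3 * - T e3 f1 f2
      + T e1 e3 f2 * - T e2 f1 f3 + T e1 e2 e3 * T f1 f2 f3 + T e1 f2 f3 * T e2 e3 f1"
  define c where "c = - (1 / 2) * i * k"
  have c: "2 * c = - i * k" unfolding c_def by simp
  let ?f1 = "f1 + c *\<^sub>R e1"
  have "frame e1 e2 e3 ?f1 f2 f3"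
    unfolding frame_def by (simp add: W_linear W_frame)
  moreover have "T e1 e2 ?f1 = 0" "T e1 e3 ?f1 = 0" "T e1 ?f1 f2 = 0" "T e1 ?f1 f3 = 0"
    by (simp_all add: T_linear T_sort \<alpha>)
  moreover have "2 * T e1 e2 f2 * - T e2 ?f1 f2 + T e1 e2 f3 * - T e3 ?f1 f2
    + T e1 e3 f2 * - T e2 ?f1 f3
      + T e1 e2 e3 * T ?f1 f2 f3 + T e1 f2 f3 * T e2 e3 ?f1 = 0"
    unfolding T_linear T_sort using c[unfolded k_def] i[unfolded pfaffian_def] by algebra
  ultimately show ?thesis by blast
qed

lemma has_form_of_pfaffian:
  assumes fr: "frame e1 e2 e3 f1 f2 f3" and pf: "pfaffian e1 e2 e3 f2 f3 \<noteq> 0"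
  shows "(\<exists>\<mu> h k. \<mu> \<noteq> 0 \<and> h \<noteq> 0 \<and> has_form 0 h \<mu> 1 k) \<or> (\<exists>\<mu>. \<mu> \<noteq> 0 \<and> has_form 0 0 \<mu> 1 0)"
proof -
  obtain e2 e3 f1 f2 f3 where fr: "frame e1 e2 e3 f1 f2 f3" and pf: "pfaffian e1 e2 e3 f2 f3 \<noteq> 0"
    and \<alpha>: "T e1 e2 f1 = 0" "T e1 e3 f1 = 0" "T e1 f1 f2 = 0" "T e1 f1 f3 = 0"
    using frame_splitting[OF fr pf] by (elim exE conjE) (rule that)
  obtain f1 where fr: "frame e1 e2 e3 f1 f2 f3"
    and \<alpha>: "T e1 e2 f1 = 0" "T e1 e3 f1 = 0" "T e1 f1 f2 = 0" "T e1 f1 f3 = 0"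
    and orth: "2 * T e1 e2 f2 * - T e2 f1 f2 + T e1 e2 f3 * - T e3 f1 f2
      + T e1 e3 f2 * - T e2 f1 f3
      + T e1 e2 e3 * T f1 f2 f3 + T e1 f2 f3 * T e2 e3 f1 = 0"
    using frame_orthogonal[OF fr pf \<alpha>] by (elim exE conjE) (rule that)
  interpret trilinear_frame W T e1 e2 e3 f1 f2 f3
    using fr by (rule trilinear_frame)
  let ?\<mu> = "(T e1 e2 f2)\<^sup>2 + T e1 e2 f3 * T e1 e3 f2 + T e1 e2 e3 * T e1 f2 f3"
  note B = T_e1_form_op[OF \<alpha> effective_relations(1)[OF fr]]
  note G = T_f1_form_op[OF \<alpha> effective_relations(4)[OF fr]]
  note \<mu> = pf[unfolded pfaffian_def]
  show ?thesis
  proof (cases "T e2 f1 f2 = 0 \<and> T e2 f1 f3 = 0 \<and> T e3 f1 f2 = 0 \<and> T e2 e3 f1 = 0 \<and>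
    T f1 f2 f3 = 0")
    case False
    have G1: "T f1 x y = 1 * W
      (form_op (- T e2 f1 f2) (- T e2 f1 f3) (- T e3 f1 f2) (T e2 e3 f1) (T f1 f2 f3) x) y"
      for x y
      unfolding mult_1 by (rule G)
    have nz: "\<not> (- T e2 f1 f2 = 0 \<and> - T e2 f1 f3 = 0 \<and> - T e3 f1 f2 = 0 \<and> T e2 e3 f1 = 0 \<and>
      T f1 f2 f3 = 0)"
      using False by simp
    have "\<exists>h k. h \<noteq> 0 \<and> has_form 0 (1 * h) ?\<mu> 1 k \<and> (1 = (0::real) \<longrightarrow> k = 0)"
      by (rule has_form_anticommuting[OF fr \<alpha> B G1 \<mu> orth nz])
    then show ?thesis using \<mu> by auto
  next
    case True
    \<comment> \<open>As \<open>T f1\<close> vanishes, the factor 0 admits any operator here; one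
      with only the coefficients \<open>p'\<close> and \<open>r'\<close> is then chosen to
      anticommute with that of \<open>e1\<close>.\<close>
    then have G0: "T f1 x y = 0 * W (form_op 0 0 0 p r x) y" for x y p r
      unfolding G[of x y] form_op_def W_comb_left by simp
    have "\<exists>p' r'. T e1 e2 e3 * r' + T e1 f2 f3 * p' = 0 \<and> \<not> (p' = 0 \<and> r' = 0)"
    proof (cases "T e1 e2 e3 = 0 \<and> T e1 f2 f3 = 0")
      case False
      then show ?thesis
        by (intro exI[of _ "T e1 e2 e3"] exI[of _ "- T e1 f2 f3"]) auto
    qed auto
    then obtain p' r' where pr: "T e1 e2 e3 * r' + T e1 f2 f3 * p' = 0" "\<not> (p' = 0 \<and> r' = 0)"
      by blast
    then have pr: "2 * T e1 e2 f2 * 0 + T e1 e2 f3 * 0 + T e1 e3 f2 * 0 + T e1 e2 e3 * r'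
      + T e1 f2 f3 * p' = 0"
      "\<not> (0 = (0::real) \<and> 0 = (0::real) \<and> 0 = (0::real) \<and> p' = 0 \<and> r' = 0)"
      by simp_all
    have "\<exists>h k. h \<noteq> 0 \<and> has_form 0 (0 * h) ?\<mu> 1 k \<and> (0 = (0::real) \<longrightarrow> k = 0)"
      by (rule has_form_anticommuting[OF fr \<alpha> B G0 \<mu> pr])
    then show ?thesis using \<mu> by auto
  qed
qed

text \<open>The coefficients on the triples $e_1, f_1, e_2$ are reached through the Lagrangian subspaces
  spanned by $e_1 + e_3, f_1 - f_3, e_2$.\<close>

lemma T_eq_0_of_null_lagrangians:
  assumes fr: "frame e1 e2 e3 f1 f2 f3"
    and null: "\<And>e1 e2 e3 f1 f2 f3. frame e1 e2 e3 f1 f2 f3 \<Longrightarrow> T e1 e2 e3 = 0"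
  shows "T x y z = 0"
proof -
  \<comment> \<open>A triple with one member of each pair becomes the first half of a frame after
    replacing some pairs e_i, f_i by f_i, -e_i.\<close>
  have lag: "T e1 e2 e3 = 0" "T e2 e3 f1 = 0" "T e1 e3 f2 = 0" "T e1 e2 f3 = 0"
    "T e1 f2 f3 = 0" "T e2 f1 f3 = 0" "T e3 f1 f2 = 0" "T f1 f2 f3 = 0"
    if "frame e1 e2 e3 f1 f2 f3" for e1 e2 e3 f1 f2 f3
  proof -
    note fr = frame_W[OF that]
    show "T e1 e2 e3 = 0" by (rule null[of _ _ _ f1 f2 f3]) (simp add: frame_def fr)
    show "T e2 e3 f1 = 0" by (rule null[of _ _ _ f2 f3 "- e1"]) (simp add: frame_def fr W_linear)
    show "T e1 e3 f2 = 0" by (rule null[of _ _ _ f1 f3 "- e2"]) (simp add: frame_def fr W_linear)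
    show "T e1 e2 f3 = 0" by (rule null[of _ _ _ f1 f2 "- e3"]) (simp add: frame_def fr W_linear)
    show "T e1 f2 f3 = 0" by (rule null[of _ _ _ f1 "- e2" "- e3"])
      (simp add: frame_def fr W_linear)
    show "T e2 f1 f3 = 0" by (rule null[of _ _ _ f2 "- e1" "- e3"])
      (simp add: frame_def fr W_linear)
    show "T e3 f1 f2 = 0" by (rule null[of _ _ _ f3 "- e1" "- e2"])
      (simp add: frame_def fr W_linear)
    show "T f1 f2 f3 = 0" by (rule null[of _ _ _ "- e1" "- e2" "- e3"])
      (simp add: frame_def fr W_linear)
  qed
  have key: "T e1 e2 f1 = 0" if that: "frame e1 e2 e3 f1 f2 f3" for e1 e2 e3 f1 f2 f3
  proof -
    interpret trilinear_frame W T e1 e2 e3 f1 f2 f3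
      using that by (rule trilinear_frame)
    have "T (e1 + e3) (f1 - f3) e2 = 0"
      by (rule null[of _ _ _ "(1 / 2) *\<^sub>R (f1 + f3)" "(1 / 2) *\<^sub>R (e3 - e1)" f2])
        (simp add: frame_def W_frame W_linear)
    then show ?thesis
      using effective_relations(2)[OF that] lag[OF that] by (simp add: T_linear T_sort)
  qed
  interpret trilinear_frame W T e1 e2 e3 f1 f2 f3
    using fr by (rule trilinear_frame)
  have "T e1 e2 f1 = 0" by (rule key[OF fr])
  moreover have "T e1 e3 f1 = 0"
    by (rule key[of _ _ e2 _ f3 f2]) (simp add: frame_def W_frame)
  moreover have "T e2 e1 f2 = 0"
    by (rule key[of _ _ e3 _ f1 f3]) (simp add: frame_def W_frame)
  moreover have "T e1 f2 f1 = 0"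
    by (rule key[of _ _ e3 _ "- e2" f3]) (simp add: frame_def W_frame W_linear)
  moreover have "T e1 f3 f1 = 0"
    by (rule key[of _ _ e2 _ "- e3" f2]) (simp add: frame_def W_frame W_linear)
  moreover have "T e2 f1 f2 = 0"
    by (rule key[of _ _ e3 _ "- e1" f3]) (simp add: frame_def W_frame W_linear)
  ultimately show ?thesis
    by (subst T_coords) (use lag[OF fr] effective_relations[OF fr] in \<open>simp add: T_sort\<close>)
qed

text \<open>The six entries of a symmetric matrix act separately: each shifts exactly one of the six
  coefficients, by a multiple of \<open>T e1 e2 e3\<close>. Symmetry keeps the new f_i mutually
  orthogonal.\<close>

lemma frame_shear:
  assumes fr: "frame e1 e2 e3 f1 f2 f3" and a: "T e1 e2 e3 \<noteq> 0"
  shows "\<exists>f1' f2' f3'. frame e1 e2 e3 f1' f2' f3' \<and>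
    T e2 e3 f1' = 0 \<and> T e1 e3 f2' = 0 \<and> T e1 e2 f3' = 0 \<and>
    T e1 e2 f1' = 0 \<and> T e1 e3 f1' = 0 \<and> T e1 e2 f2' = 0"
proof -
  interpret trilinear_frame W T e1 e2 e3 f1 f2 f3
    using fr by (rule trilinear_frame)
  define i where "i = 1 / T e1 e2 e3"
  have i: "i * T e1 e2 e3 = 1" using a unfolding i_def by simp
  define s11 s22 s33 s12 s13 s23 where s: "s11 = - i * T e2 e3 f1" "s22 = i * T e1 e3 f2"
    "s33 = - i * T e1 e2 f3"
    "s12 = i * T e1 e3 f1" "s13 = - i * T e1 e2 f1" "s23 = - i * T e1 e2 f2"
  let ?f1 = "f1 + s11 *\<^sub>R e1 + s12 *\<^sub>R e2 + s13 *\<^sub>R e3"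
    and ?f2 = "f2 + s12 *\<^sub>R e1 + s22 *\<^sub>R e2 + s23 *\<^sub>R e3"
    and ?f3 = "f3 + s13 *\<^sub>R e1 + s23 *\<^sub>R e2 + s33 *\<^sub>R e3"
  have "frame e1 e2 e3 ?f1 ?f2 ?f3"
    unfolding frame_def by (simp add: W_linear W_frame)
  moreover have "T e2 e3 ?f1 = 0" "T e1 e3 ?f2 = 0" "T e1 e2 ?f3 = 0"
    "T e1 e2 ?f1 = 0" "T e1 e3 ?f1 = 0" "T e1 e2 ?f2 = 0"
    unfolding T_linear T_sort T_same s using i by algebra+
  ultimately show ?thesis by blast
qed

lemma has_form_decomposable:
  assumes fr: "frame e1 e2 e3 f1 f2 f3" and nz: "T x y z \<noteq> 0"
    and null: "\<And>e1 e2 e3 f1 f2 f3. frame e1 e2 e3 f1 f2 f3 \<Longrightarrow> pfaffian e1 e2 e3 f2 f3 = 0"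
  shows "\<exists>a. a \<noteq> 0 \<and> has_form a 0 0 0 0"
proof -
  obtain e1 e2 e3 f1 f2 f3 where fr: "frame e1 e2 e3 f1 f2 f3" and a: "T e1 e2 e3 \<noteq> 0"
    using T_eq_0_of_null_lagrangians[OF fr] nz by metis
  obtain f1 f2 f3 where fr: "frame e1 e2 e3 f1 f2 f3"
    and fee: "T e2 e3 f1 = 0" "T e1 e3 f2 = 0" "T e1 e2 f3 = 0"
      "T e1 e2 f1 = 0" "T e1 e3 f1 = 0" "T e1 e2 f2 = 0"
    using frame_shear[OF fr a] by (elim exE conjE) (rule that)
  interpret trilinear_frame W T e1 e2 e3 f1 f2 f3
    using fr by (rule trilinear_frame)
  note rel = effective_relations[OF fr]
  \<comment> \<open>By \<open>fee\<close> each Pfaffian reduces, up to sign, to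
    \<open>T e1 e2 e3\<close> times a single coefficient.\<close>
  have "pfaffian e1 e2 e3 f2 f3 = 0" "pfaffian e2 e1 e3 f1 f3 = 0" "pfaffian e3 e1 e2 f1 f2 = 0"
    by (rule null[of _ _ _ f1] null[of _ _ _ f2] null[of _ _ _ f3], simp add: frame_def W_frame;
      fail)+
  then have 1: "T e1 f2 f3 = 0" "T e2 f1 f3 = 0" "T e3 f1 f2 = 0"
    using fee rel a by (simp_all add: pfaffian_def T_sort)
  \<comment> \<open>Along e_i + e_j two mixed coefficients survive; effectivity merges them into
    twice one of them.\<close>
  have "pfaffian (e1 + e2) e2 e3 (f2 - f1) f3 = 0"
    by (rule null[of _ _ _ f1]) (simp add: frame_def W_frame W_linear)
  moreover have "pfaffian (e1 + e3) e3 e2 (f3 - f1) f2 = 0"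
    by (rule null[of _ _ _ f1]) (simp add: frame_def W_frame W_linear)
  moreover have "pfaffian (e2 + e3) e3 e1 (f3 - f2) f1 = 0"
    by (rule null[of _ _ _ f2]) (simp add: frame_def W_frame W_linear)
  ultimately have 2: "T e1 f1 f3 = 0" "T e1 f1 f2 = 0" "T e2 f1 f2 = 0"
    using fee rel a 1 by (simp_all add: pfaffian_def T_sort T_linear)
  have "pfaffian (e1 + f1) e2 e3 f2 f3 = 0"
    by (rule null[of _ _ _ f1]) (simp add: frame_def W_frame W_linear)
  then have "T f1 f2 f3 = 0"
    using fee rel a 1 2 by (simp add: pfaffian_def T_sort T_linear)
  then have "diagonal (T e1 e2 e3) 0 0 0 0 e1 e2 e3 f1 f2 f3"
    unfolding diagonal_def using fr fee rel 1 2 by simp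
  then show ?thesis using a unfolding has_form_def by blast
qed

lemma has_form_zero:
  assumes fr: "frame e1 e2 e3 f1 f2 f3" and "\<And>x y z. T x y z = 0"
  shows "has_form 0 0 0 0 0"
proof -
  have "diagonal 0 0 0 0 0 e1 e2 e3 f1 f2 f3"
    unfolding diagonal_def using fr by (simp add: assms(2))
  then show ?thesis unfolding has_form_def by blast
qed

section \<open>Normalising the coefficients\<close>

lemma has_form_normalized:
  assumes "has_form 0 h \<mu> 1 k" "h \<noteq> 0" "\<mu> \<noteq> 0"
  shows "\<exists>k. has_form 0 (sgn h) (sgn \<mu>) 1 k"
proof -
  \<comment> \<open>With \<open>s1 * s2\<close> as third factor the coefficient 1 is kept, while
    \<open>h\<close> is multiplied by \<open>s2\<^sup>2\<close> and \<mu> by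
    \<open>s1\<^sup>2\<close>.\<close>
  define s1 s2 where s: "s1 = 1 / sqrt \<bar>\<mu>\<bar>" "s2 = 1 / sqrt \<bar>h\<bar>"
  have s0: "s1 \<noteq> 0" "s2 \<noteq> 0" "s1 * s2 \<noteq> 0" using assms unfolding s by simp_all
  have "h * (s2 * (s1 * s2) / s1) = h * s2\<^sup>2" using s0 by (simp add: power2_eq_square)
  also have "\<dots> = sgn h" unfolding s using assms by (simp add: power_divide sgn_real_def)
  finally have 1: "h * (s2 * (s1 * s2) / s1) = sgn h" .
  have "\<mu> * (s1 * (s1 * s2) / s2) = \<mu> * s1\<^sup>2" using s0 by (simp add: power2_eq_square)
  also have "\<dots> = sgn \<mu>" unfolding s using assms by (simp add: power_divide sgn_real_def)
  finally have 2: "\<mu> * (s1 * (s1 * s2) / s2) = sgn \<mu>" .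
  have 3: "1 * (s1 * s2 / (s1 * s2)) = 1" using s0 by simp
  show ?thesis
    using has_form_scale[OF assms(1) s0] unfolding 1 2 3 by auto
qed

lemma has_form_normalized_degenerate:
  assumes "has_form 0 0 \<mu> 1 0" "\<mu> \<noteq> 0"
  shows "has_form 0 0 (sgn \<mu>) 1 0"
proof -
  define s where s: "s = 1 / sqrt \<bar>\<mu>\<bar>"
  have s0: "s \<noteq> 0" using assms unfolding s by simp
  have "\<mu> * (s * s / 1) = sgn \<mu>"
    unfolding s using assms by (simp add: sgn_real_def flip: power2_eq_square)
      (simp add: power_divide)
  moreover have "1 * (s * 1 / s) = 1" using s0 by simp
  ultimately show ?thesis
    using has_form_scale[OF assms(1) s0 one_neq_zero s0] by simp
qed

text \<open>When the third and fifth coefficients have opposite signs, the form splits over the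
  reals into two decomposable ones, which is type (1).\<close>

lemma has_form_hyperbolic_normalized:
  assumes "has_form 0 1 (- \<epsilon>) 1 k" "\<epsilon> = 1 \<or> \<epsilon> = - 1" "\<epsilon> * k > 0"
  shows "\<exists>\<gamma>. \<gamma> \<noteq> 0 \<and> has_form 1 0 0 0 \<gamma>"
proof -
  define c where "c = sqrt \<bar>k\<bar>"
  have c: "c > 0" using assms unfolding c_def by auto
  have k: "k = \<epsilon> * c\<^sup>2" using assms unfolding c_def by (auto simp: zero_less_mult_iff)
  have e: "\<epsilon> \<noteq> 0" using assms(2) by auto
  \<comment> \<open>The parameters of \<open>has_form_hyperbolic\<close> are
    \<open>b = 1 / c\<close> and the triple \<open>c\<close>, \<open>\<epsilon> * c\<close>,
    \<open>c\<close>.\<close>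
  have "has_form (1 / c / 2) 0 0 0 (4 * (1 / c) * (c * (\<epsilon> * c) * c))"
    using assms(1) c e unfolding k
    by (intro has_form_hyperbolic) (simp_all add: power2_eq_square mult_ac)
  note h = this
  have c2: "2 * c \<noteq> 0" and c1: "1 / c / 2 * (2 * c * 1 * 1) = 1" using c by simp_all
  from has_form_scale[OF h c2 one_neq_zero one_neq_zero]
  have "has_form 1 0 0 0 (4 * (1 / c) * (c * (\<epsilon> * c) * c) / (2 * c * 1 * 1))"
    unfolding c1 mult_zero_left .
  moreover have "4 * (1 / c) * (c * (\<epsilon> * c) * c) / (2 * c * 1 * 1) \<noteq> 0" using c e by simp
  ultimately show ?thesis by blast
qed

lemma normal_form_cases:
  assumes fr: "frame e1 e2 e3 f1 f2 f3"
  shows "(\<exists>\<gamma>. \<gamma> \<noteq> 0 \<and> has_form 1 0 0 0 \<gamma>) \<or> (\<exists>\<nu>. \<nu> \<noteq> 0 \<and> has_form 0 1 1 1 (\<nu>\<^sup>2)) \<or>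
    (\<exists>\<nu>. \<nu> \<noteq> 0 \<and> has_form 0 1 (- 1) 1 (- \<nu>\<^sup>2)) \<or> has_form 0 1 1 1 0 \<or> has_form 0 1 (- 1) 1 0 \<or>
    has_form 0 0 1 1 0 \<or> has_form 0 0 (- 1) 1 0 \<or> has_form 1 0 0 0 0 \<or> has_form 0 0 0 0 0"
proof (cases "\<exists>e1 e2 e3 f1 f2 f3. frame e1 e2 e3 f1 f2 f3 \<and> pfaffian e1 e2 e3 f2 f3 \<noteq> 0")
  case True
  then obtain \<mu> h k where "\<mu> \<noteq> 0 \<and> h \<noteq> 0 \<and> has_form 0 h \<mu> 1 k \<or> \<mu> \<noteq> 0 \<and> has_form 0 0 \<mu> 1 0"
    using has_form_of_pfaffian by metis
  then consider k where "h \<noteq> 0" "\<mu> \<noteq> 0" "has_form 0 (sgn h) (sgn \<mu>) 1 k" | "\<mu> \<noteq> 0"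
    "has_form 0 0 (sgn \<mu>) 1 0"
    using has_form_normalized has_form_normalized_degenerate by metis
  then show ?thesis
  proof cases
    case 1
    \<comment> \<open>Exchanging indices and reversing a pair bring every sign pattern to one whose
      first sign is positive.\<close>
    have "\<exists>\<epsilon> k. (\<epsilon> = 1 \<or> \<epsilon> = - 1) \<and> has_form 0 1 \<epsilon> 1 k"
    proof (cases "h > 0")
      case True
      then show ?thesis using 1 by (intro exI[of _ "sgn \<mu>"] exI[of _ k]) (auto simp: sgn_real_def)
    next
      case False
      then have h: "has_form 0 (- 1) (sgn \<mu>) 1 k" using 1 by (simp add: sgn_real_def)
      show ?thesis
      proof (cases "\<mu> > 0")
        case True
        then show ?thesis using has_form_swap_23[OF h] by (intro exI[of _ 1] exI[of _ "- k"]) simp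
      next
        case False
        then have "has_form 0 (- 1) (- 1) 1 k" using h 1 by (simp add: sgn_real_def)
        from has_form_scale[OF has_form_swap_12[OF this], of "- 1" 1 1] show ?thesis
          by (intro exI[of _ 1] exI[of _ k]) simp
      qed
    qed
    then obtain \<epsilon> k where \<epsilon>: "\<epsilon> = 1 \<or> \<epsilon> = - 1" and h: "has_form 0 1 \<epsilon> 1 k" by blast
    \<comment> \<open>The sign of \<open>\<epsilon> * k\<close> decides: negative gives type (1),
      positive (2) or (3), zero (4) or (5).\<close>
    have "\<exists>\<gamma>. \<gamma> \<noteq> 0 \<and> has_form 1 0 0 0 \<gamma>" if "\<epsilon> * k < 0"
      using has_form_hyperbolic_normalized[of "- \<epsilon>" k] that h \<epsilon> by auto
    moreover have "\<exists>\<nu>. \<nu> \<noteq> 0 \<and> has_form 0 1 \<epsilon> 1 (\<epsilon> * \<nu>\<^sup>2)" if "\<epsilon> * k > 0"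
    proof -
      have "\<epsilon> * (sqrt \<bar>k\<bar>)\<^sup>2 = k" using that \<epsilon> by auto
      moreover have "sqrt \<bar>k\<bar> \<noteq> 0" using that by auto
      ultimately show ?thesis using h by metis
    qed
    ultimately show ?thesis using \<epsilon> h by (cases "\<epsilon> * k" "0 :: real" rule: linorder_cases) auto
  next
    case 2
    then show ?thesis by (cases "\<mu> > 0") (simp_all add: sgn_real_def)
  qed
next
  case False
  then have null: "frame e1 e2 e3 f1 f2 f3 \<Longrightarrow> pfaffian e1 e2 e3 f2 f3 = 0" for e1 e2 e3 f1 f2 f3
    by blast
  show ?thesis
  proof (cases "\<forall>x y z. T x y z = 0")
    case True
    then show ?thesis using has_form_zero[OF fr] by blast
  next
    case False
    then obtain x y z where "T x y z \<noteq> 0" by blast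
    then have "\<exists>a. a \<noteq> 0 \<and> has_form a 0 0 0 0"
      by (rule has_form_decomposable[OF fr]) (rule null)
    then obtain a where a: "a \<noteq> 0" "has_form a 0 0 0 0" by blast
    then have "1 / a \<noteq> 0" by simp
    from has_form_scale[OF a(2) this one_neq_zero one_neq_zero] show ?thesis using a(1) by simp
  qed
qed

end

context symplectic_space
begin

section \<open>Invariants\<close>

definition casimir_sum where
  "casimir_sum e1 e2 e3 f1 f2 f3 \<beta> =
     \<beta> e1 f1 + \<beta> e2 f2 + \<beta> e3 f3 - \<beta> f1 e1 - \<beta> f2 e2 - (\<beta> f3 e3 :: real)"

lemma casimir_sum_frame:
  assumes "frame e1 e2 e3 f1 f2 f3" "frame g1 g2 g3 h1 h2 h3" "bilinear \<beta>"
  shows "casimir_sum e1 e2 e3 f1 f2 f3 \<beta> = casimir_sum g1 g2 g3 h1 h2 h3 \<beta>"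
  unfolding casimir_sum_def by (rule casimir[OF assms])

text \<open>Up to sign this is $(X, Y) \mapsto tr(A_X A_Y)$, where
  $W(A_X u, v) = T(X, u, v)$.\<close>

definition trace_form where
  "trace_form e1 e2 e3 f1 f2 f3 T X Y =
     casimir_sum e1 e2 e3 f1 f2 f3 (\<lambda>u v.
       casimir_sum e1 e2 e3 f1 f2 f3 (\<lambda>u' v'. T X u u' * T Y v v'))"

text \<open>The order of the tests matters, each assuming that the earlier ones failed. Once q is
  nonzero, equality in the Cauchy-Schwarz relation expresses rank one. The test for 1 asks for a
  nonzero real eigenvalue of the operator that represents q through \<open>W\<close>.\<close>

definition form_type :: "'v \<Rightarrow> 'v \<Rightarrow> 'v \<Rightarrow> 'v \<Rightarrow> 'v \<Rightarrow> 'v \<Rightarrow> ('v \<Rightarrow> 'v \<Rightarrow> 'v \<Rightarrow> real) \<Rightarrow> nat" where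
  "form_type e1 e2 e3 f1 f2 f3 T =
     (let q = trace_form e1 e2 e3 f1 f2 f3 T in
      if \<forall>x y z. T x y z = 0 then 9
      else if \<forall>x y. q x y = 0 then 8
      else if \<forall>x y. q x x * q y y = (q x y)\<^sup>2 then (if \<exists>x. q x x > 0 then 6 else 7)
      else if \<exists>c x. c \<noteq> 0 \<and> x \<noteq> 0 \<and> (\<forall>y. q x y = c * W x y) then 1
      else if \<forall>x. x \<noteq> 0 \<longrightarrow> (\<exists>y. q x y \<noteq> 0) then (if \<exists>x. q x x > 0 then 2 else 3)
      else (if \<exists>x. q x x > 0 then 4 else 5))"

lemma form_typeI:
  fixes T e1 e2 e3 f1 f2 f3
  defines "q \<equiv> trace_form e1 e2 e3 f1 f2 f3 T"
  assumes "T x0 y0 z0 \<noteq> 0"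
  shows "q x1 y1 \<noteq> 0 \<Longrightarrow> q x2 x2 * q y2 y2 \<noteq> (q x2 y2)\<^sup>2 \<Longrightarrow>
      c \<noteq> 0 \<Longrightarrow> x3 \<noteq> 0 \<Longrightarrow> (\<And>y. q x3 y = c * W x3 y) \<Longrightarrow> form_type e1 e2 e3 f1 f2 f3 T = 1"
    and "q x1 y1 \<noteq> 0 \<Longrightarrow> q x2 x2 * q y2 y2 \<noteq> (q x2 y2)\<^sup>2 \<Longrightarrow>
      (\<And>c x. c \<noteq> 0 \<Longrightarrow> (\<And>y. q x y = c * W x y) \<Longrightarrow> x = 0) \<Longrightarrow>
      (\<And>x. (\<And>y. q x y = 0) \<Longrightarrow> x = 0) \<Longrightarrow>
      form_type e1 e2 e3 f1 f2 f3 T = (if \<exists>x. q x x > 0 then 2 else 3)"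
    and "q x1 y1 \<noteq> 0 \<Longrightarrow> q x2 x2 * q y2 y2 \<noteq> (q x2 y2)\<^sup>2 \<Longrightarrow>
      (\<And>c x. c \<noteq> 0 \<Longrightarrow> (\<And>y. q x y = c * W x y) \<Longrightarrow> x = 0) \<Longrightarrow>
      x3 \<noteq> 0 \<Longrightarrow> (\<And>y. q x3 y = 0) \<Longrightarrow>
      form_type e1 e2 e3 f1 f2 f3 T = (if \<exists>x. q x x > 0 then 4 else 5)"
    and "q x1 y1 \<noteq> 0 \<Longrightarrow> (\<And>x y. q x x * q y y = (q x y)\<^sup>2) \<Longrightarrow>
      form_type e1 e2 e3 f1 f2 f3 T = (if \<exists>x. q x x > 0 then 6 else 7)"
    and "(\<And>x y. q x y = 0) \<Longrightarrow> form_type e1 e2 e3 f1 f2 f3 T = 8"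
proof -
  have nz: "(\<forall>x y z. T x y z = 0) \<longleftrightarrow> False" using assms by blast
  note d = form_type_def[of e1 e2 e3 f1 f2 f3 T, folded q_def, unfolded Let_def nz if_False]
  show "form_type e1 e2 e3 f1 f2 f3 T = 8" if "\<And>x y. q x y = 0"
    unfolding d using that by simp
  have q0: "(\<forall>x y. q x y = 0) \<longleftrightarrow> False" if "q x1 y1 \<noteq> 0" using that by blast
  show "form_type e1 e2 e3 f1 f2 f3 T = (if \<exists>x. q x x > 0 then 6 else 7)"
    if "q x1 y1 \<noteq> 0" "\<And>x y. q x x * q y y = (q x y)\<^sup>2"
    unfolding d q0[OF that(1)] if_False using that by simp
  have q2: "(\<forall>x y. q x x * q y y = (q x y)\<^sup>2) \<longleftrightarrow> False" if "q x2 x2 * q y2 y2 \<noteq> (q x2 y2)\<^sup>2"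
    using that by blast
  show "form_type e1 e2 e3 f1 f2 f3 T = 1" if "q x1 y1 \<noteq> 0" "q x2 x2 * q y2 y2 \<noteq> (q x2 y2)\<^sup>2"
    "c \<noteq> 0" "x3 \<noteq> 0" "\<And>y. q x3 y = c * W x3 y"
  proof -
    have "\<exists>c x. c \<noteq> 0 \<and> x \<noteq> 0 \<and> (\<forall>y. q x y = c * W x y)" using that by blast
    then show ?thesis unfolding d q0[OF that(1)] q2[OF that(2)] if_False by (rule if_P)
  qed
  show "form_type e1 e2 e3 f1 f2 f3 T = (if \<exists>x. q x x > 0 then 2 else 3)"
    if 1: "q x1 y1 \<noteq> 0" and 2: "q x2 x2 * q y2 y2 \<noteq> (q x2 y2)\<^sup>2"
      and 3: "\<And>c x. c \<noteq> 0 \<Longrightarrow> (\<And>y. q x y = c * W x y) \<Longrightarrow> x = 0"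
      and 4: "\<And>x. (\<And>y. q x y = 0) \<Longrightarrow> x = 0"
  proof -
    have q3: "(\<exists>c x. c \<noteq> 0 \<and> x \<noteq> 0 \<and> (\<forall>y. q x y = c * W x y)) \<longleftrightarrow> False"
      using 3 by blast
    have "\<forall>x. x \<noteq> 0 \<longrightarrow> (\<exists>y. q x y \<noteq> 0)" using 4 by blast
    then show ?thesis unfolding d q0[OF 1] q2[OF 2] q3 if_False by (rule if_P)
  qed
  show "form_type e1 e2 e3 f1 f2 f3 T = (if \<exists>x. q x x > 0 then 4 else 5)"
    if 1: "q x1 y1 \<noteq> 0" and 2: "q x2 x2 * q y2 y2 \<noteq> (q x2 y2)\<^sup>2"
      and 3: "\<And>c x. c \<noteq> 0 \<Longrightarrow> (\<And>y. q x y = c * W x y) \<Longrightarrow> x = 0"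
      and 4: "x3 \<noteq> 0" "\<And>y. q x3 y = 0"
  proof -
    have q3: "(\<exists>c x. c \<noteq> 0 \<and> x \<noteq> 0 \<and> (\<forall>y. q x y = c * W x y)) \<longleftrightarrow> False"
      using 3 by blast
    have "\<not> (\<forall>x. x \<noteq> 0 \<longrightarrow> (\<exists>y. q x y \<noteq> 0))" using 4 by blast
    then show ?thesis unfolding d q0[OF 1] q2[OF 2] q3 if_False by (rule if_not_P)
  qed
qed

end

context symplectic_trilinear
begin

text \<open>The inner and the outer contraction are each independent of the frame, so they are
  changed one after the other.\<close>

lemma trace_form_frame:
  assumes "frame e1 e2 e3 f1 f2 f3" "frame g1 g2 g3 h1 h2 h3"
  shows "trace_form e1 e2 e3 f1 f2 f3 T X Y = trace_form g1 g2 g3 h1 h2 h3 T X Y"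
proof -
  have inner: "bilinear (\<lambda>u' v'. T X u u' * T Y v v')" for u v
    unfolding bilinear_def linear_iff by (simp add: T_linear algebra_simps)
  have outer: "bilinear (\<lambda>u v. casimir_sum g1 g2 g3 h1 h2 h3 (\<lambda>u' v'. T X u u' * T Y v v'))"
    unfolding bilinear_def linear_iff casimir_sum_def by (simp add: T_linear algebra_simps)
  have "trace_form e1 e2 e3 f1 f2 f3 T X Y =
      casimir_sum e1 e2 e3 f1 f2 f3 (\<lambda>u v.
      casimir_sum g1 g2 g3 h1 h2 h3 (\<lambda>u' v'. T X u u' * T Y v v'))"
    unfolding trace_form_def casimir_sum_frame[OF assms inner] ..
  also have "\<dots> = trace_form g1 g2 g3 h1 h2 h3 T X Y"
    unfolding trace_form_def by (rule casimir_sum_frame[OF assms outer])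
  finally show ?thesis .
qed

text \<open>\<open>F\<close> maps frames to frames, so the trace form of the pulled back form is
  that of \<open>T\<close> at the images. Every test quantifies over all vectors and is unaffected
  by the bijective substitution.\<close>

lemma form_type_invariant:
  assumes F: "linear F" "bij F" "\<And>x y. W (F x) (F y) = W x y" and fr: "frame e1 e2 e3 f1 f2 f3"
  shows "form_type e1 e2 e3 f1 f2 f3 (\<lambda>x y z. T (F x) (F y) (F z))
    = form_type e1 e2 e3 f1 f2 f3 T"
proof -
  have "frame (F e1) (F e2) (F e3) (F f1) (F f2) (F f3)"
    using fr unfolding frame_def F(3) .
  from trace_form_frame[OF this fr]
  have q: "trace_form e1 e2 e3 f1 f2 f3 (\<lambda>x y z. T (F x) (F y) (F z)) =
      (\<lambda>X Y. trace_form e1 e2 e3 f1 f2 f3 T (F X) (F Y))"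
    unfolding trace_form_def casimir_sum_def by simp
  have surj: "(\<forall>x. P (F x)) \<longleftrightarrow> (\<forall>x. P x)" "(\<exists>x. P (F x)) \<longleftrightarrow> (\<exists>x. P x)" for P
    using bij_is_surj[OF F(2)] by (metis surjD)+
  have F0: "F x = 0 \<longleftrightarrow> x = 0" for x
    using F(1,2) by (metis bij_is_inj injD linear_0)
  define q where "q = trace_form e1 e2 e3 f1 f2 f3 T"
  have 1: "(\<forall>x y z. T (F x) (F y) (F z) = 0) \<longleftrightarrow> (\<forall>x y z. T x y z = 0)"
    by (simp only: surj(1)[of "\<lambda>z. T _ _ z = 0"] surj(1)[of "\<lambda>y. \<forall>z. T _ y z = 0"]
      surj(1)[of "\<lambda>x. \<forall>y z. T x y z = 0"])
  have 2: "(\<forall>x y. q (F x) (F y) = 0) \<longleftrightarrow> (\<forall>x y. q x y = 0)"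
    by (simp only: surj(1)[of "\<lambda>y. q _ y = 0"] surj(1)[of "\<lambda>x. \<forall>y. q x y = 0"])
  have 3: "(\<forall>x y. q (F x) (F x) * q (F y) (F y) = (q (F x) (F y))\<^sup>2)
      \<longleftrightarrow> (\<forall>x y. q x x * q y y = (q x y)\<^sup>2)"
    by (simp only: surj(1)[of "\<lambda>y. q (F _) (F _) * q y y = (q (F _) y)\<^sup>2"]
      surj(1)[of "\<lambda>x. \<forall>y. q x x * q y y = (q x y)\<^sup>2"])
  have 4: "(\<exists>x. q (F x) (F x) > 0) \<longleftrightarrow> (\<exists>x. q x x > 0)"
    by (rule surj(2))
  have "(\<exists>x. x \<noteq> 0 \<and> (\<forall>y. q x y = c * W x y))
      \<longleftrightarrow> (\<exists>x. x \<noteq> 0 \<and> (\<forall>y. q (F x) (F y) = c * W x y))" for c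
    unfolding surj(2)[symmetric, of "\<lambda>x. x \<noteq> 0 \<and> (\<forall>y. q x y = c * W x y)"]
    unfolding surj(1)[symmetric, of "\<lambda>y. q (F _) y = c * W (F _) y"] F0 F(3) ..
  then have 5: "(\<exists>c x. c \<noteq> 0 \<and> x \<noteq> 0 \<and> (\<forall>y. q (F x) (F y) = c * W x y))
      \<longleftrightarrow> (\<exists>c x. c \<noteq> 0 \<and> x \<noteq> 0 \<and> (\<forall>y. q x y = c * W x y))"
    by metis
  have 6: "(\<forall>x. x \<noteq> 0 \<longrightarrow> (\<exists>y. q (F x) (F y) \<noteq> 0)) \<longleftrightarrow> (\<forall>x. x \<noteq> 0 \<longrightarrow> (\<exists>y. q x y \<noteq> 0))"
    unfolding surj(1)[symmetric, of "\<lambda>x. x \<noteq> 0 \<longrightarrow> (\<exists>y. q x y \<noteq> 0)"]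
    unfolding surj(2)[of "\<lambda>y. q (F _) y \<noteq> 0"] F0 ..
  show ?thesis
    unfolding form_type_def q Let_def q_def[symmetric] 1 2 3 4 5 6 ..
qed

end

section \<open>Values of the invariants on the normal forms\<close>

context trilinear_frame
begin

lemma trace_form_diagonal:
  assumes "T e1 e2 e3 = a0" "T e2 e3 f1 = a1" "T e1 e3 f2 = a2" "T e1 e2 f3 = a3" "T f1 f2 f3 = k"
    "T e1 f2 f3 = 0" "T e2 f1 f3 = 0" "T e3 f1 f2 = 0"
    "T e1 e2 f1 = 0" "T e1 e3 f1 = 0" "T e1 f1 f2 = 0" "T e1 f1 f3 = 0"
    "T e1 e2 f2 = 0" "T e2 e3 f2 = 0" "T e2 f1 f2 = 0" "T e2 f2 f3 = 0"
    "T e1 e3 f3 = 0" "T e2 e3 f3 = 0" "T e3 f1 f3 = 0" "T e3 f2 f3 = 0"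
  shows "trace_form e1 e2 e3 f1 f2 f3 T X Y =
    4 * (a2 * a3 * (W X f1 * W Y f1) - a1 * a3 * (W X f2 * W Y f2) + a1 * a2 * (W X f3 * W Y f3)
      + k * (a1 * (W e1 X * W e1 Y) - a2 * (W e2 X * W e2 Y) + a3 * (W e3 X * W e3 Y)))
    + 2 * a0 * k * (W X f1 * W e1 Y + W e1 X * W Y f1 + W X f2 * W e2 Y + W e2 X * W Y f2
      + W X f3 * W e3 Y + W e3 X * W Y f3)"
proof -
  have T: "T v y z = W v f1 * T e1 y z + W v f2 * T e2 y z + W v f3 * T e3 y z
      + W e1 v * T f1 y z + W e2 v * T f2 y z + W e3 v * T f3 y z" for v y z
    by (subst frame_expand[OF frame, of v]) (simp only: T_linear)
  show ?thesis
    unfolding trace_form_def casimir_sum_def T[of X] T[of Y] T_sort T_same assms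
    by algebra
qed

end

context symplectic_space
begin

lemma frame_eq_0:
  assumes "frame e1 e2 e3 f1 f2 f3" "W x f1 = 0" "W x f2 = 0" "W x f3 = 0" "W e1 x = 0"
    "W e2 x = 0" "W e3 x = 0"
  shows "x = 0"
  using frame_expand[OF assms(1), of x] assms(2-) by simp

text \<open>The family of \<open>diagonal\<close> as an explicit trilinear map; the covector dual to
  e_i is \<open>W\<close> paired with f_i on the right, and the one dual to f_i is \<open>W\<close>
  applied to e_i.\<close>

definition normal_form where
  "normal_form e1 e2 e3 f1 f2 f3 a0 a1 a2 a3 k x y z =
     a0 * det3 (\<lambda>v. W v f1) (\<lambda>v. W v f2) (\<lambda>v. W v f3) x y z
     + a1 * det3 (W e1) (\<lambda>v. W v f2) (\<lambda>v. W v f3) x y z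
     + a2 * det3 (W e2) (\<lambda>v. W v f1) (\<lambda>v. W v f3) x y z
     + a3 * det3 (W e3) (\<lambda>v. W v f1) (\<lambda>v. W v f2) x y z
     + k * det3 (W e1) (W e2) (W e3) x y z"

lemma normal_form_trilinear:
  "symplectic_trilinear W (normal_form e1 e2 e3 f1 f2 f3 a0 a1 a2 a3 k)"
  by unfold_locales (unfold normal_form_def det3_def W_linear, algebra+)

lemma normal_form_trace:
  assumes "frame e1 e2 e3 f1 f2 f3"
  shows "trace_form e1 e2 e3 f1 f2 f3 (normal_form e1 e2 e3 f1 f2 f3 a0 a1 a2 a3 k) X Y =
    4 * (a2 * a3 * (W X f1 * W Y f1) - a1 * a3 * (W X f2 * W Y f2) + a1 * a2 * (W X f3 * W Y f3)
      + k * (a1 * (W e1 X * W e1 Y) - a2 * (W e2 X * W e2 Y) + a3 * (W e3 X * W e3 Y)))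
    + 2 * a0 * k * (W X f1 * W e1 Y + W e1 X * W Y f1 + W X f2 * W e2 Y + W e2 X * W Y f2
      + W X f3 * W e3 Y + W e3 X * W Y f3)"
proof -
  interpret symplectic_trilinear W "normal_form e1 e2 e3 f1 f2 f3 a0 a1 a2 a3 k"
    by (rule normal_form_trilinear)
  interpret trilinear_frame W "normal_form e1 e2 e3 f1 f2 f3 a0 a1 a2 a3 k" e1 e2 e3 f1 f2 f3
    by unfold_locales (rule assms)
  show ?thesis
    by (rule trace_form_diagonal) (simp_all add: normal_form_def det3_def frame_W[OF assms])
qed

text \<open>With \<open>s\<close> equal to 1 or -1 this covers types (2) to (5) together. The
  equation decouples over the planes of e_j and f_j, where an eigenvalue would satisfy
  \<open>c\<^sup>2 = - 16 * n\<close>.\<close>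

lemma normal_form_no_eigenvector:
  assumes fr: "frame e1 e2 e3 f1 f2 f3" and s: "s\<^sup>2 = 1" and n: "n \<ge> 0" and c: "c \<noteq> 0"
    and q: "\<And>y. trace_form e1 e2 e3 f1 f2 f3 (normal_form e1 e2 e3 f1 f2 f3 0 1 s 1 (s * n)) x y
      = c * W x y"
  shows "x = 0"
proof -
  \<comment> \<open>The equations in one plane: \<open>u\<close> and \<open>v\<close> are the
    coordinates of \<open>x\<close> there, and \<open>t\<close> is the sign of that plane.\<close>
  have z: "u = 0 \<and> v = 0" if 1: "4 * t * u = - (c * v)" and 2: "4 * t * n * v = c * u"
    and t: "t\<^sup>2 = 1"
    for t u v :: real
  proof -
    have "(16 * n + c\<^sup>2) * v = 0" using 1 2 t by algebra
    moreover have "16 * n + c\<^sup>2 > 0" using n c by (simp add: add_nonneg_pos)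
    ultimately have "v = 0" by simp
    then show ?thesis using 2 c by simp
  qed
  note q' = q[unfolded normal_form_trace[OF fr]] and fW = frame_W[OF fr]
  have s1: "s * (s * t) = t" for t using s by (simp add: power2_eq_square flip: mult.assoc)
  have "W x f1 = 0 \<and> W e1 x = 0"
    by (rule z[of s]) (use q'[of e1] q'[of f1] s in \<open>simp_all add: fW W_anti[of x e1] mult_ac\<close>)
  moreover have "W x f2 = 0 \<and> W e2 x = 0"
    by (rule z[of "- 1"]) (use q'[of e2] q'[of f2] in
      \<open>simp_all add: fW W_anti[of x e2] mult_ac s1\<close>)
  moreover have "W x f3 = 0 \<and> W e3 x = 0"
    by (rule z[of s]) (use q'[of e3] q'[of f3] s in \<open>simp_all add: fW W_anti[of x e3] mult_ac\<close>)
  ultimately show ?thesis using frame_eq_0[OF fr] by blast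
qed

lemma normal_form_nondegenerate:
  assumes fr: "frame e1 e2 e3 f1 f2 f3" and s: "s \<noteq> 0" and n: "n \<noteq> 0"
    and q: "\<And>y. trace_form e1 e2 e3 f1 f2 f3 (normal_form e1 e2 e3 f1 f2 f3 0 1 s 1 (s * n)) x y
      = 0"
  shows "x = 0"
proof -
  note q' = q[unfolded normal_form_trace[OF fr]] and fW = frame_W[OF fr]
  show ?thesis
    by (rule frame_eq_0[OF fr])
      (use q'[of e1] q'[of f1] q'[of e2] q'[of f2] q'[of e3] q'[of f3] s n in \<open>simp_all add: fW\<close>)
qed

lemma form_type_normal_form:
  fixes e1 e2 e3 f1 f2 f3
  assumes fr: "frame e1 e2 e3 f1 f2 f3"
  defines "ty \<equiv> \<lambda>a0 a1 a2 a3 k.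
  form_type e1 e2 e3 f1 f2 f3 (normal_form e1 e2 e3 f1 f2 f3 a0 a1 a2 a3 k)"
  shows "\<gamma> \<noteq> 0 \<Longrightarrow> ty 1 0 0 0 \<gamma> = 1"
    and "\<nu> \<noteq> 0 \<Longrightarrow> ty 0 1 1 1 (\<nu>\<^sup>2) = 2"
    and "\<nu> \<noteq> 0 \<Longrightarrow> ty 0 1 (- 1) 1 (- \<nu>\<^sup>2) = 3"
    and "ty 0 1 1 1 0 = 4"
    and "ty 0 1 (- 1) 1 0 = 5"
    and "ty 0 0 1 1 0 = 6"
    and "ty 0 0 (- 1) 1 0 = 7"
    and "ty 1 0 0 0 0 = 8"
    and "ty 0 0 0 0 0 = 9"
proof -
  note fW = frame_W[OF fr]
  note q = normal_form_trace[OF fr]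
  note N = normal_form_def[of e1 e2 e3 f1 f2 f3] det3_def
  have e1: "e1 \<noteq> 0" and f1: "f1 \<noteq> 0" using fW(7) by auto
  show "ty 1 0 0 0 \<gamma> = 1" if "\<gamma> \<noteq> 0"
    unfolding ty_def
    by (rule form_typeI(1)[of _ e1 e2 e3 _ _ _ _ _ _ e1 f1 e1 f1 "2 * \<gamma>" e1])
      (use that e1 in \<open>simp_all add: N q fW\<close>)
  let ?q = "\<lambda>s n. trace_form e1 e2 e3 f1 f2 f3 (normal_form e1 e2 e3 f1 f2 f3 0 1 s 1 (s * n))"
  have nondeg: "ty 0 1 s 1 (s * n) = (if \<exists>x. ?q s n x x > 0 then 2 else 3)" if "s\<^sup>2 = 1" "n > 0"
    for s n :: real
    unfolding ty_def
  proof (rule form_typeI(2)[of _ e1 e2 f3 _ _ _ _ _ _ e1 e1 e1 e2])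
    show "x = 0" if "c \<noteq> 0" "\<And>y. ?q s n x y = c * W x y" for c x
      using normal_form_no_eigenvector[OF fr \<open>s\<^sup>2 = 1\<close> _ that] \<open>n > 0\<close> by simp
    show "x = 0" if "\<And>y. ?q s n x y = 0" for x
      using normal_form_nondegenerate[OF fr _ _ that] \<open>n > 0\<close> \<open>s\<^sup>2 = 1\<close> by force
  qed (use that in \<open>auto simp: N q fW\<close>)
  have deg: "ty 0 1 s 1 0 = (if \<exists>x. ?q s 0 x x > 0 then 4 else 5)" if "s\<^sup>2 = 1" for s :: real
  proof -
    have "form_type e1 e2 e3 f1 f2 f3 (normal_form e1 e2 e3 f1 f2 f3 0 1 s 1 (s * 0)) =
      (if \<exists>x. ?q s 0 x x > 0 then 4 else 5)"
    proof (rule form_typeI(3)[of _ e1 e2 f3 _ _ _ _ _ _ e1 e1 e1 e2 f1])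
      show "x = 0" if "c \<noteq> 0" "\<And>y. ?q s 0 x y = c * W x y" for c x
        using normal_form_no_eigenvector[OF fr \<open>s\<^sup>2 = 1\<close> _ that] by simp
    qed (use that f1 in \<open>auto simp: N q fW\<close>)
    then show ?thesis unfolding ty_def by simp
  qed
  have pos: "\<exists>x. ?q 1 n x x > 0" for n
    by (rule exI[of _ e1]) (simp add: q fW)
  \<comment> \<open>For this sign all six coefficients of the diagonal quadratic form are
    nonpositive.\<close>
  have "?q (- 1) n x x \<le> 0" if "n \<ge> 0" for n x
  proof -
    have "n * (W e1 x * W e1 x + W e2 x * W e2 x + W e3 x * W e3 x) \<ge> 0" using that by simp
    moreover have "W x f1 * W x f1 \<ge> 0" "W x f2 * W x f2 \<ge> 0" "W x f3 * W x f3 \<ge> 0" by simp_all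
    ultimately show ?thesis unfolding q by (simp del: zero_le_square; linarith)
  qed
  then have npos: "\<not> (\<exists>x. ?q (- 1) n x x > 0)" if "n \<ge> 0" for n
    using that by (meson not_le)
  show "ty 0 1 1 1 (\<nu>\<^sup>2) = 2" if "\<nu> \<noteq> 0"
    using nondeg[of 1 "\<nu>\<^sup>2"] pos[of "\<nu>\<^sup>2"] that by simp
  show "ty 0 1 (- 1) 1 (- \<nu>\<^sup>2) = 3" if "\<nu> \<noteq> 0"
    using nondeg[of "- 1" "\<nu>\<^sup>2"] npos[of "\<nu>\<^sup>2"] that by simp
  show "ty 0 1 1 1 0 = 4" using deg[of 1] pos[of 0] by simp
  show "ty 0 1 (- 1) 1 0 = 5" using deg[of "- 1"] npos[of 0] by simp
  have "ty 0 0 1 1 0 = (if \<exists>x.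
    trace_form e1 e2 e3 f1 f2 f3 (normal_form e1 e2 e3 f1 f2 f3 0 0 1 1 0) x x > 0 then 6 else 7)"
    unfolding ty_def
    by (rule form_typeI(4)[of _ e1 e2 f3 _ _ _ _ _ _ e1 e1])
      (simp_all add: N q fW power2_eq_square)
  moreover have "trace_form e1 e2 e3 f1 f2 f3 (normal_form e1 e2 e3 f1 f2 f3 0 0 1 1 0) e1 e1 > 0"
    by (simp add: q fW)
  ultimately show "ty 0 0 1 1 0 = 6" by (metis (no_types, lifting))
  have "ty 0 0 (- 1) 1 0 = (if \<exists>x.
    trace_form e1 e2 e3 f1 f2 f3 (normal_form e1 e2 e3 f1 f2 f3 0 0 (- 1) 1 0) x x > 0 then 6
    else 7)"
    unfolding ty_def
    by (rule form_typeI(4)[of _ e1 e2 f3 _ _ _ _ _ _ e1 e1])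
      (simp_all add: N q fW power2_eq_square)
  then show "ty 0 0 (- 1) 1 0 = 7" by (simp add: q not_less)
  show "ty 1 0 0 0 0 = 8"
    unfolding ty_def
    by (rule form_typeI(5)[of _ e1 e2 e3]) (simp_all add: N q fW)
  show "ty 0 0 0 0 0 = 9"
    unfolding ty_def form_type_def by (simp add: normal_form_def)
qed

end

section \<open>The classification\<close>

lemma (in symplectic_trilinear) alternating_form_T:
  "alternating_form 3 (\<lambda>x. T (x 0) (x 1) (x 2))"
proof -
  have lin: "linear (\<lambda>v. T v y z)" "linear (\<lambda>v. T y v z)" "linear (\<lambda>v. T y z v)" for y z
    by (simp_all add: linear_iff T_linear)
  have 3: "i < 3 \<longleftrightarrow> i = 0 \<or> i = 1 \<or> i = 2" for i :: nat by auto
  show ?thesis unfolding alternating_form_def 3 using lin by (auto simp: less_2_cases_iff)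
qed

text \<open>Positions after 2 repeat the last vector; a 3-form ignores them.\<close>

definition triple :: "'v \<Rightarrow> 'v \<Rightarrow> 'v \<Rightarrow> nat \<Rightarrow> 'v" where
  "triple u v w = (\<lambda>i. if i = 0 then u else if i = 1 then v else w)"

lemma alternating_form_triple:
  assumes "alternating_form 3 \<omega>"
  shows "\<omega> x = \<omega> (triple (x 0) (x 1) (x 2))"
    and "linear (\<lambda>v. \<omega> (triple v y z))" "linear (\<lambda>v. \<omega> (triple y v z))"
      "linear (\<lambda>v. \<omega> (triple y z v))"
    and "\<omega> (triple y y z) = 0" "\<omega> (triple z y y) = 0"
proof -
  have 3: "i < 3 \<longleftrightarrow> i = 0 \<or> i = 1 \<or> i = 2" for i :: nat by auto
  note a = assms[unfolded alternating_form_def]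
  have eq: "x 0 = y 0 \<Longrightarrow> x 1 = y 1 \<Longrightarrow> x 2 = y 2 \<Longrightarrow> \<omega> x = \<omega> y" for x y
    using a unfolding 3 by blast
  have lin: "linear (\<lambda>v. \<omega> (x(0 := v)))" "linear (\<lambda>v. \<omega> (x(1 := v)))"
    "linear (\<lambda>v. \<omega> (x(2 := v)))" for x
    using a unfolding 3 by blast+
  show "\<omega> x = \<omega> (triple (x 0) (x 1) (x 2))"
    by (rule eq) (simp_all add: triple_def)
  have "\<omega> ((triple y y z)(0 := v)) = \<omega> (triple v y z)"
    "\<omega> ((triple y y z)(1 := v)) = \<omega> (triple y v z)"
    "\<omega> ((triple y z z)(2 := v)) = \<omega> (triple y z v)" for v
    by (rule eq; simp add: triple_def)+
  then show "linear (\<lambda>v. \<omega> (triple v y z))" "linear (\<lambda>v. \<omega> (triple y v z))"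
    "linear (\<lambda>v. \<omega> (triple y z v))"
    using lin(1)[of "triple y y z"] lin(2)[of "triple y y z"] lin(3)[of "triple y z z"]
      by simp_all
  have alt: "i < j \<Longrightarrow> j < 3 \<Longrightarrow> x i = x j \<Longrightarrow> \<omega> x = 0" for x i j using a by blast
  show "\<omega> (triple y y z) = 0" by (rule alt[of 0 1]) (simp_all add: triple_def)
  show "\<omega> (triple z y y) = 0" by (rule alt[of 1 2]) (simp_all add: triple_def)
qed

context symplectic_space
begin

text \<open>Each monomial has one covector from every pair, so its product with any summand of the
  symplectic form repeats a factor. In coordinates this is a polynomial identity.\<close>

lemma normal_form_effective:
  fixes e1 e2 e3 f1 f2 f3 and a0 a1 a2 a3 k :: real
  defines "N \<equiv> normal_form e1 e2 e3 f1 f2 f3 a0 a1 a2 a3 k"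
  assumes fr: "frame e1 e2 e3 f1 f2 f3"
  shows "effective (\<lambda>x. W (x 0) (x 1)) (\<lambda>x. N (x 0) (x 1) (x 2))"
proof -
  interpret symplectic_trilinear W N unfolding N_def by (rule normal_form_trilinear)
  define X1 X2 X3 where X: "X1 = (\<lambda>v. W v f1)" "X2 = (\<lambda>v. W v f2)" "X3 = (\<lambda>v. W v f3)"
  define Y1 Y2 Y3 where Y: "Y1 = W e1" "Y2 = W e2" "Y3 = W e3"
  have expand: "v = X1 v *\<^sub>R e1 + X2 v *\<^sub>R e2 + X3 v *\<^sub>R e3 + Y1 v *\<^sub>R f1 + Y2 v *\<^sub>R f2
    + Y3 v *\<^sub>R f3" for v
    using frame_expand[OF fr, of v] unfolding X Y .
  have W: "W u v = X1 u * Y1 v - X1 v * Y1 u + (X2 u * Y2 v - X2 v * Y2 u)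
    + (X3 u * Y3 v - X3 v * Y3 u)" for u v
    by (subst expand[of u], subst expand[of v]) (simp add: W_linear frame_W[OF fr] algebra_simps)
  have N: "N u v w = a0 * det3 X1 X2 X3 u v w + a1 * det3 Y1 X2 X3 u v w
    + a2 * det3 Y2 X1 X3 u v w
      + a3 * det3 Y3 X1 X2 u v w + k * det3 Y1 Y2 Y3 u v w" for u v w
    unfolding N_def normal_form_def X Y ..
  have "wedge 3 2 (\<lambda>x. N (x 0) (x 1) (x 2)) (\<lambda>x. W (x 0) (x 1)) = (\<lambda>x. 0)"
    unfolding wedge_3_2[of N W, OF T_perm(2) T_perm(1) W_anti]
    by (rule ext, unfold N W det3_def, algebra)
  then show ?thesis unfolding effective_def using alternating_form_T by blast
qed

lemma effective_imp_trilinear: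
  assumes fr: "frame e1 e2 e3 f1 f2 f3" and \<omega>: "effective (\<lambda>x. W (x 0) (x 1)) \<omega>"
  defines "T \<equiv> \<lambda>x y z. \<omega> (triple x y z)"
  shows "effective_trilinear W T" and "\<omega> = (\<lambda>x. T (x 0) (x 1) (x 2))"
proof -
  note alt = alternating_form_triple[OF \<omega>[unfolded effective_def, THEN conjunct1]]
  show eq: "\<omega> = (\<lambda>x. T (x 0) (x 1) (x 2))"
    unfolding T_def using alt(1) by (rule ext)
  have lin: "linear (\<lambda>v. T v y z)" "linear (\<lambda>v. T y v z)" "linear (\<lambda>v. T y z v)" for y z
    unfolding T_def by (rule alt)+
  have same: "T x x y = 0" "T y x x = 0" for x y using alt(5,6) unfolding T_def by simp_all
  interpret symplectic_trilinear W T
  proof unfold_locales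
    show "T (x + x') y z = T x y z + T x' y z" "T (c *\<^sub>R x) y z = c * T x y z" for x x' y z c
      using linear_add[OF lin(1)] linear_scale[OF lin(1)] by simp_all
    show "T y x z = - T x y z" for x y z
      using same(1)[of "x + y" z] same(1)[of x z] same(1)[of y z]
      by (simp add: linear_add[OF lin(1)] linear_add[OF lin(2)])
    show "T x z y = - T x y z" for x y z
      using same(2)[of x "y + z"] same(2)[of x y] same(2)[of x z]
      by (simp add: linear_add[OF lin(2)] linear_add[OF lin(3)])
  qed
  interpret trilinear_frame W T e1 e2 e3 f1 f2 f3
    by unfold_locales (rule fr)
  define five where "five a b c d e i = (if i = 0 then a else if i = 1 then b else if i = 2 then c
    else if i = 3 then d else (e :: 'v))" for a b c d e and i :: nat
  have five: "five a b c d e 0 = a" "five a b c d e 1 = b" "five a b c d e 2 = c"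
    "five a b c d e 3 = d" "five a b c d e 4 = e" for a b c d e
    unfolding five_def by simp_all
  have "wedge 3 2 (\<lambda>x. T (x 0) (x 1) (x 2)) (\<lambda>x. W (x 0) (x 1)) = (\<lambda>x. 0)"
    using \<omega> unfolding effective_def eq by blast
  note w = fun_cong[OF this[unfolded wedge_3_2[of T W, OF T_perm(2) T_perm(1) W_anti]]]
  note w' = w[of "five _ _ _ _ _", unfolded five]
  have "T u e1 f1 + T u e2 f2 + T u e3 f3 = 0" for u
  proof -
    \<comment> \<open>Evaluating the product on a frame vector and the two pairs not containing it
      isolates one contraction.\<close>
    have "T e1 e2 f2 + T e1 e3 f3 = 0" using w'[of e1 e2 f2 e3 f3] by (simp add: W_frame)
    moreover have "T e2 e1 f1 + T e2 e3 f3 = 0" using w'[of e2 e1 f1 e3 f3] by (simp add: W_frame)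
    moreover have "T e3 e1 f1 + T e3 e2 f2 = 0" using w'[of e3 e1 f1 e2 f2] by (simp add: W_frame)
    moreover have "T f1 e2 f2 + T f1 e3 f3 = 0" using w'[of f1 e2 f2 e3 f3] by (simp add: W_frame)
    moreover have "T f2 e1 f1 + T f2 e3 f3 = 0" using w'[of f2 e1 f1 e3 f3] by (simp add: W_frame)
    moreover have "T f3 e1 f1 + T f3 e2 f2 = 0" using w'[of f3 e1 f1 e2 f2] by (simp add: W_frame)
    ultimately show ?thesis
      by (subst (1 2 3) frame_expand[OF fr, of u]) (simp add: T_linear; algebra)
  qed
  note base = this
  show "effective_trilinear W T"
  proof unfold_locales
    fix g1 g2 g3 h1 h2 h3 u
    assume g: "frame g1 g2 g3 h1 h2 h3"
    \<comment> \<open>Invariance of the contraction carries the relation from the given frame to an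
      arbitrary one.\<close>
    have "bilinear (T u)" unfolding bilinear_def linear_iff by (simp add: T_linear)
    from casimir_sum_frame[OF fr g this] show "T u g1 h1 + T u g2 h2 + T u g3 h3 = 0"
      unfolding casimir_sum_def
      using base[of u] T_perm(1)[where x=u and y=e1 and z=f1]
        T_perm(1)[where x=u and y=e2 and z=f2]
        T_perm(1)[where x=u and y=e3 and z=f3] T_perm(1)[where x=u and y=g1 and z=h1]
        T_perm(1)[where x=u and y=g2 and z=h2] T_perm(1)[where x=u and y=g3 and z=h3]
      by linarith
  qed
qed

end

context effective_trilinear
begin

text \<open>The required symplectic map sends the fixed frame to one in which \<open>T\<close> is
  diagonal.\<close>

lemma has_form_imp_equivalent:
  assumes fr: "frame e1 e2 e3 f1 f2 f3" and "has_form a0 a1 a2 a3 k"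
  shows "symplectic_equivalent (\<lambda>x. W (x 0) (x 1)) (\<lambda>x. T (x 0) (x 1) (x 2))
    (\<lambda>x. normal_form e1 e2 e3 f1 f2 f3 a0 a1 a2 a3 k (x 0) (x 1) (x 2))"
proof -
  obtain g1 g2 g3 h1 h2 h3 where d: "diagonal a0 a1 a2 a3 k g1 g2 g3 h1 h2 h3"
    using assms(2) unfolding has_form_def by blast
  interpret trilinear_frame W T g1 g2 g3 h1 h2 h3
    using d by (rule diagonal_trilinear_frame)
  define F where "F x = W x f1 *\<^sub>R g1 + W x f2 *\<^sub>R g2 + W x f3 *\<^sub>R g3
      + W e1 x *\<^sub>R h1 + W e2 x *\<^sub>R h2 + W e3 x *\<^sub>R h3" for x
  have lin: "linear F"
    unfolding linear_iff F_def by (simp add: W_linear algebra_simps)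
  have coords: "W (F x) h1 = W x f1" "W (F x) h2 = W x f2" "W (F x) h3 = W x f3"
    "W g1 (F x) = W e1 x" "W g2 (F x) = W e2 x" "W g3 (F x) = W e3 x" for x
    unfolding F_def by (simp_all add: W_linear W_frame)
  have W: "W (F x) (F y) = W x y" for x y
  proof -
    have "W x y = W x f1 * W e1 y + W x f2 * W e2 y + W x f3 * W e3 y
        + W e1 x * W f1 y + W e2 x * W f2 y + W e3 x * W f3 y"
      by (subst frame_expand[OF fr, of x]) (simp add: W_linear)
    also have "\<dots> = W (F x) (F y)"
      unfolding F_def[of x] by (simp add: W_linear coords W_anti[of h1] W_anti[of h2]
        W_anti[of h3]
        W_anti[of f1 y] W_anti[of f2 y] W_anti[of f3 y])
    finally show ?thesis ..
  qed
  have "inj F"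
    unfolding linear_injective_0[OF lin]
  proof (intro allI impI)
    fix x assume "F x = 0"
    then show "x = 0"
      using coords[of x] by (intro frame_eq_0[OF fr]) simp_all
  qed
  moreover have "v \<in> range F" for v
  proof -
    have "v = F (W v h1 *\<^sub>R e1 + W v h2 *\<^sub>R e2 + W v h3 *\<^sub>R e3 + W g1 v *\<^sub>R f1 + W g2 v *\<^sub>R f2
      + W g3 v *\<^sub>R f3)"
      unfolding F_def using frame_expand[OF frame, of v] by (simp add: W_linear frame_W[OF fr])
    then show ?thesis by (rule range_eqI)
  qed
  ultimately have "bij F" unfolding bij_def by blast
  moreover have "T (F x) (F y) (F z) = normal_form e1 e2 e3 f1 f2 f3 a0 a1 a2 a3 k x y z"
    for x y z
    unfolding T_coords[of "F x" "F y" "F z"] diagonal_values[OF d] normal_form_def det3_def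
      coords by algebra
  ultimately show ?thesis
    unfolding symplectic_equivalent_def symplectic_group_def pullback_def
    using lin W by (intro bexI[of _ F]) simp_all
qed

end

section \<open>Assembling the classification\<close>

context symplectic_space
begin

definition normal_form_set :: "'v \<Rightarrow> 'v \<Rightarrow> 'v \<Rightarrow> 'v \<Rightarrow> 'v \<Rightarrow> 'v \<Rightarrow> nat \<Rightarrow> ('v \<Rightarrow> 'v \<Rightarrow> 'v \<Rightarrow> real) set"
  where
  "normal_form_set e1 e2 e3 f1 f2 f3 i =
     (let N = normal_form e1 e2 e3 f1 f2 f3 in
      [{N 1 0 0 0 \<gamma> | \<gamma>. \<gamma> \<noteq> 0}, {N 0 1 1 1 (\<nu>\<^sup>2) | \<nu>. \<nu> \<noteq> 0}, {N 0 1 (- 1) 1 (- \<nu>\<^sup>2) | \<nu>. \<nu> \<noteq> 0},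
       {N 0 1 1 1 0}, {N 0 1 (- 1) 1 0}, {N 0 0 1 1 0}, {N 0 0 (- 1) 1 0}, {N 1 0 0 0 0},
       {N 0 0 0 0 0}] ! (i - 1))"

lemma one_to_nine: "i \<in> {1..9} \<longleftrightarrow> i = 1 \<or> i = 2 \<or> i = 3 \<or> i = 4 \<or> i = 5 \<or> i = 6 \<or> i = 7 \<or> i = 8 \<or>
  i = (9 :: nat)"
  by auto

lemma normal_form_set_simps:
  fixes e1 e2 e3 f1 f2 f3 :: 'v
  defines "S \<equiv> normal_form_set e1 e2 e3 f1 f2 f3" and "N \<equiv> normal_form e1 e2 e3 f1 f2 f3"
  shows "S 1 = {N 1 0 0 0 \<gamma> | \<gamma>. \<gamma> \<noteq> 0}" "S 2 = {N 0 1 1 1 (\<nu>\<^sup>2) | \<nu>. \<nu> \<noteq> 0}"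
    "S 3 = {N 0 1 (- 1) 1 (- \<nu>\<^sup>2) | \<nu>. \<nu> \<noteq> 0}" "S 4 = {N 0 1 1 1 0}" "S 5 = {N 0 1 (- 1) 1 0}"
    "S 6 = {N 0 0 1 1 0}" "S 7 = {N 0 0 (- 1) 1 0}" "S 8 = {N 1 0 0 0 0}" "S 9 = {N 0 0 0 0 0}"
  unfolding S_def N_def normal_form_set_def Let_def by simp_all

lemma normal_form_set_type:
  assumes fr: "frame e1 e2 e3 f1 f2 f3" and "i \<in> {1..9}" "N \<in> normal_form_set e1 e2 e3 f1 f2 f3 i"
  shows "form_type e1 e2 e3 f1 f2 f3 N = i"
  using assms(2,3) form_type_normal_form[OF fr] unfolding one_to_nine
  by (elim disjE; hypsubst; unfold normal_form_set_simps; blast)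

lemma normal_form_set_cases:
  assumes "N \<in> normal_form_set e1 e2 e3 f1 f2 f3 i" "i \<in> {1..9}"
  shows "\<exists>a0 a1 a2 a3 k. N = normal_form e1 e2 e3 f1 f2 f3 a0 a1 a2 a3 k"
  using assms unfolding one_to_nine
  by (elim disjE; hypsubst; unfold normal_form_set_simps; blast)

theorem effective_classification:
  assumes fr: "frame e1 e2 e3 f1 f2 f3"
  defines "\<Omega> \<equiv> \<lambda>x :: nat \<Rightarrow> 'v. W (x 0) (x 1)"
    and "S \<equiv> \<lambda>i. (\<lambda>N x. N (x 0) (x 1) (x 2)) ` normal_form_set e1 e2 e3 f1 f2 f3 i"
  shows "(\<forall>i\<in>{1..9}. \<forall>\<omega>\<in>S i. effective \<Omega> \<omega>) \<and>
         (\<forall>\<omega>. effective \<Omega> \<omega> \<longrightarrow>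
            (\<exists>!i. i \<in> {1..9} \<and> (\<exists>\<omega>'\<in>S i. symplectic_equivalent \<Omega> \<omega> \<omega>')))"
proof (intro conjI ballI allI impI)
  fix i \<omega> assume "i \<in> {1..9 :: nat}" "\<omega> \<in> S i"
  then obtain N where \<omega>: "\<omega> = (\<lambda>x. N (x 0) (x 1) (x 2))"
    and N: "N \<in> normal_form_set e1 e2 e3 f1 f2 f3 i"
    unfolding S_def by blast
  obtain a0 a1 a2 a3 k where "N = normal_form e1 e2 e3 f1 f2 f3 a0 a1 a2 a3 k"
    using normal_form_set_cases[OF N \<open>i \<in> {1..9}\<close>] by blast
  then show "effective \<Omega> \<omega>"
    unfolding \<omega> \<Omega>_def using normal_form_effective[OF fr] by simp
next
  fix \<omega> :: "(nat \<Rightarrow> 'v) \<Rightarrow> real" assume \<omega>: "effective \<Omega> \<omega>"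
  define T where "T x y z = \<omega> (triple x y z)" for x y z
  have T: "effective_trilinear W T" and \<omega>T: "\<omega> = (\<lambda>x. T (x 0) (x 1) (x 2))"
    using effective_imp_trilinear[OF fr \<omega>[unfolded \<Omega>_def]] unfolding T_def .
  interpret effective_trilinear W T by (rule T)
  have equiv: "\<exists>i. i \<in> {1..9} \<and> (\<exists>\<omega>'\<in>S i. symplectic_equivalent \<Omega> \<omega> \<omega>')"
  proof -
    have *: "\<exists>i. i \<in> {1..9} \<and> (\<exists>\<omega>'\<in>S i. symplectic_equivalent \<Omega> \<omega> \<omega>')"
      if "has_form a0 a1 a2 a3 k"
        "normal_form e1 e2 e3 f1 f2 f3 a0 a1 a2 a3 k \<in> normal_form_set e1 e2 e3 f1 f2 f3 i"
        "i \<in> {1..9}" for a0 a1 a2 a3 k i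
    proof (intro exI conjI bexI)
      show "symplectic_equivalent \<Omega> \<omega> (\<lambda>x.
        normal_form e1 e2 e3 f1 f2 f3 a0 a1 a2 a3 k (x 0) (x 1) (x 2))"
        unfolding \<Omega>_def \<omega>T by (rule has_form_imp_equivalent[OF fr that(1)])
      show "(\<lambda>x. normal_form e1 e2 e3 f1 f2 f3 a0 a1 a2 a3 k (x 0) (x 1) (x 2)) \<in> S i"
        unfolding S_def using that(2) by (rule rev_image_eqI) (rule refl)
    qed (rule that(3))
    show ?thesis
      using normal_form_cases[OF fr]
    proof (elim disjE exE conjE)
      fix \<gamma> :: real assume "\<gamma> \<noteq> 0" "has_form 1 0 0 0 \<gamma>"
      then show ?thesis by (intro *[of _ _ _ _ _ 1])
        (auto simp only: normal_form_set_simps one_to_nine)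
    next
      fix \<nu> :: real assume "\<nu> \<noteq> 0" "has_form 0 1 1 1 (\<nu>\<^sup>2)"
      then show ?thesis by (intro *[of _ _ _ _ _ 2])
        (auto simp only: normal_form_set_simps one_to_nine)
    next
      fix \<nu> :: real assume "\<nu> \<noteq> 0" "has_form 0 1 (- 1) 1 (- \<nu>\<^sup>2)"
      then show ?thesis by (intro *[of _ _ _ _ _ 3])
        (auto simp only: normal_form_set_simps one_to_nine)
    next
      assume "has_form 0 1 1 1 0"
      then show ?thesis by (intro *[of _ _ _ _ _ 4])
        (auto simp only: normal_form_set_simps one_to_nine)
    next
      assume "has_form 0 1 (- 1) 1 0"
      then show ?thesis by (intro *[of _ _ _ _ _ 5])
        (auto simp only: normal_form_set_simps one_to_nine)
    next
      assume "has_form 0 0 1 1 0"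
      then show ?thesis by (intro *[of _ _ _ _ _ 6])
        (auto simp only: normal_form_set_simps one_to_nine)
    next
      assume "has_form 0 0 (- 1) 1 0"
      then show ?thesis by (intro *[of _ _ _ _ _ 7])
        (auto simp only: normal_form_set_simps one_to_nine)
    next
      assume "has_form 1 0 0 0 0"
      then show ?thesis by (intro *[of _ _ _ _ _ 8])
        (auto simp only: normal_form_set_simps one_to_nine)
    next
      assume "has_form 0 0 0 0 0"
      then show ?thesis by (intro *[of _ _ _ _ _ 9])
        (auto simp only: normal_form_set_simps one_to_nine)
    qed
  qed
  \<comment> \<open>Uniqueness: every admissible index is computed from \<open>T\<close>
    alone.\<close>
  have "i = form_type e1 e2 e3 f1 f2 f3 T"
    if i: "i \<in> {1..9}" and equiv_i: "\<exists>\<omega>'\<in>S i. symplectic_equivalent \<Omega> \<omega> \<omega>'" for i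
  proof -
    obtain N F where N: "N \<in> normal_form_set e1 e2 e3 f1 f2 f3 i" and F: "F \<in> symplectic_group \<Omega>"
      and eq: "(\<lambda>x. N (x 0) (x 1) (x 2)) = pullback F \<omega>"
      using equiv_i unfolding S_def symplectic_equivalent_def by blast
    have triple: "triple x y z 0 = x" "triple x y z 1 = y" "triple x y z 2 = z" for x y z :: 'v
      unfolding triple_def by simp_all
    have "N x y z = T (F x) (F y) (F z)" for x y z
      using fun_cong[OF eq, of "triple x y z"] unfolding pullback_def \<omega>T triple .
    then have N_eq: "N = (\<lambda>x y z. T (F x) (F y) (F z))" by blast
    have "pullback F \<Omega> = \<Omega>" using F unfolding symplectic_group_def by blast
    from fun_cong[OF this, of "triple _ _ _"] have "W (F x) (F y) = W x y" for x y
      unfolding pullback_def \<Omega>_def triple .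
    then have "form_type e1 e2 e3 f1 f2 f3 N = form_type e1 e2 e3 f1 f2 f3 T"
      unfolding N_eq using F unfolding symplectic_group_def by (intro form_type_invariant fr) auto
    then show ?thesis using normal_form_set_type[OF fr i N] by simp
  qed
  with equiv show "\<exists>!i. i \<in> {1..9} \<and> (\<exists>\<omega>'\<in>S i. symplectic_equivalent \<Omega> \<omega> \<omega>')"
    by metis
qed

end

theorem theorem2p8:
  fixes \<Omega> :: "'v::real_vector form"
    and e1 e2 e3 f1 f2 f3 :: 'v
  assumes "dim (UNIV :: 'v set) = 6"
    and "symplectic_form \<Omega>"
    and "symplectic_basis \<Omega> e1 e2 e3 f1 f2 f3"
  shows "(\<forall>i\<in>{1..9}. \<forall>\<omega>\<in>normal_forms_of_type e1 e2 e3 f1 f2 f3 i. effective \<Omega> \<omega>) \<and>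
         (\<forall>\<omega>. effective \<Omega> \<omega> \<longrightarrow>
            (\<exists>!i. i \<in> {1..9} \<and>
               (\<exists>\<omega>'\<in>normal_forms_of_type e1 e2 e3 f1 f2 f3 i. symplectic_equivalent \<Omega> \<omega> \<omega>')))"
proof -
  define B where "B = {e1, e2, e3, f1, f2, f3}"
  note b = assms(3)[unfolded symplectic_basis_def Let_def, folded B_def]
  have dist: "distinct [e1, e2, e3, f1, f2, f3]" and ind: "independent B"
    and span: "span B = UNIV"
    using b by blast+
  define c where "c b v = representation B v b" for b v
  have d: "dual_form B b = (\<lambda>x. c b (x 0))" for b
    unfolding dual_form_def c_def ..
  define W where "W u v = c e1 u * c f1 v - c e1 v * c f1 u + (c e2 u * c f2 v - c e2 v * c f2 u)
    + (c e3 u * c f3 v - c e3 v * c f3 u)" for u v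
  have \<Omega>: "\<Omega> = (\<lambda>x. W (x 0) (x 1))"
    using b unfolding d wedge_1_1 W_def by simp
  have c_add: "c b (u + v) = c b u + c b v" and c_scale: "c b (r *\<^sub>R v) = r * c b v" for b u v r
    unfolding c_def using ind span by (simp_all add: representation_add representation_scale)
  have c_basis: "c b b' = (if b' = b then 1 else 0)" if "b' \<in> B" for b b'
    unfolding c_def representation_basis[OF ind that] by auto
  have in_B: "e1 \<in> B" "e2 \<in> B" "e3 \<in> B" "f1 \<in> B" "f2 \<in> B" "f3 \<in> B" unfolding B_def by auto
  note c_B = in_B[THEN c_basis]
  interpret symplectic_space W
  proof
    show "W (x + y) z = W x z + W y z" "W (r *\<^sub>R x) z = r * W x z" "W x y = - W y x" for x y z r
      unfolding W_def by (simp_all add: c_add c_scale algebra_simps)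
    have "finite B" "card B = 6" using dist unfolding B_def by simp_all
    then show "\<exists>S. finite S \<and> card S \<le> 6 \<and> span S = (UNIV :: 'v set)"
      using span by auto
  qed
  \<comment> \<open>The reversed list supplies the inequalities in the other orientation, which the
    conditions from \<open>c_B\<close> also require.\<close>
  have dist': "distinct [f3, f2, f1, e3, e2, e1]" using dist by auto
  have fr: "frame e1 e2 e3 f1 f2 f3"
    unfolding frame_def W_def using dist dist' by (simp add: c_B)
  have coords: "c e1 = (\<lambda>v. W v f1)" "c e2 = (\<lambda>v. W v f2)" "c e3 = (\<lambda>v. W v f3)"
    "c f1 = W e1" "c f2 = W e2" "c f3 = W e3"
    unfolding W_def using dist dist' by (simp_all add: c_B)
  have wedge: "wedge111 (\<lambda>x. c b (x 0)) (\<lambda>x. c b' (x 0)) (\<lambda>x. c b'' (x 0)) =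
      (\<lambda>x. det3 (c b) (c b') (c b'') (x 0) (x 1) (x 2))" for b b' b''
    unfolding wedge_1_1_1 det3_def ..
  \<comment> \<open>Moves the image inside the comprehension for the three families with a
    parameter.\<close>
  have img: "g ` {f u | u. P u} = {g (f u) | u. P u}"
    for f :: "real \<Rightarrow> 'v \<Rightarrow> 'v \<Rightarrow> 'v \<Rightarrow> real" and g :: "_ \<Rightarrow> 'v form" and P
    by blast
  have "normal_forms_of_type e1 e2 e3 f1 f2 f3 i =
      (\<lambda>N x. N (x 0) (x 1) (x 2)) ` normal_form_set e1 e2 e3 f1 f2 f3 i" if "i \<in> {1..9}" for i
    using that unfolding one_to_nine
    unfolding normal_forms_of_type_def normal_forms_def Let_def B_def[symmetric] d wedge
    by (elim disjE; hypsubst; unfold normal_form_set_simps img)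
      (simp_all add: normal_form_def coords[symmetric] algebra_simps)
  with effective_classification[OF fr, folded \<Omega>] show ?thesis
    by (metis (no_types, lifting))
qed

end
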